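(* Let $\beta_0=0.50057$. For all real $\beta\ge \beta_0$, all integers $n\ge 1$ and all $A\subset\{0,1\}^n$ with $|A|\le \frac12$, \[ \mathbf{E}\, h_A^\beta \ \ge\ |A|\,\big(\log_2(1/|A|)\big)^\beta . \] Moreover, this is an equality if $A$ is a subcube.
   Context: The Hamming cube $\{0,1\}^n$ is viewed as a graph in which two vertices are joined by an edge iff they differ in exactly one coordinate. For $A\subset\{0,1\}^n$ and $x\in A$, $h_A(x)$ is the number of edges connecting $x$ with the complement of $A$; $h_A(x)=0$ if $x\notin A$. For $f:\{0,1\}^n\to\mathbb{R}$, $\mathbf{E}f=2^{-n}\sum_{x\in\{0,1\}^n}f(x)$, and $|A|=\mathbf{E}\mathbf{1}_A=2^{-n}\#A$ is the normalized measure of $A$. The right-hand side is read as $0$ when $|A|=0$. A subcube (of codimension $k$) is a set obtained by prescribing the values of $k$ of the coordinates, e.g. $\{x: x_1=\cdots=x_k=0\}$. *)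

theory Defs
  imports Complex_Main "HOL-Library.Indicator_Function"
begin

text \<open>
  Points of the cube are lists of length \<open>n\<close>, with \<open>False\<close> for 0 and \<open>True\<close> for 1; the
  coordinates are numbered from 0.
\<close>

definition cube :: "nat \<Rightarrow> bool list set" where
  "cube n = {x. length x = n}"

definition cube_edges :: "nat \<Rightarrow> bool list set set" where
  "cube_edges n =
     {{x, y} | x y. x \<in> cube n \<and> y \<in> cube n \<and> card {i. i < n \<and> x ! i \<noteq> y ! i} = 1}"

definition boundary_degree :: "nat \<Rightarrow> bool list set \<Rightarrow> bool list \<Rightarrow> nat" where
  "boundary_degree n A x =
     (if x \<in> A then card {e \<in> cube_edges n. \<exists>y \<in> cube n - A. e = {x, y}} else 0)"

definition cube_mean :: "nat \<Rightarrow> (bool list \<Rightarrow> real) \<Rightarrow> real" where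
  "cube_mean n f = (\<Sum>x\<in>cube n. f x) / 2 ^ n"

definition cube_measure :: "nat \<Rightarrow> bool list set \<Rightarrow> real" where
  "cube_measure n A = cube_mean n (indicator A)"

text \<open>
  \<open>I\<close> is the set of prescribed coordinates and \<open>c\<close> gives their values, so the codimension is
  \<open>card I\<close>.
\<close>

definition is_subcube :: "nat \<Rightarrow> bool list set \<Rightarrow> bool" where
  "is_subcube n A \<longleftrightarrow>
     (\<exists>I c. I \<subseteq> {..<n} \<and> A = {x \<in> cube n. \<forall>i\<in>I. x ! i = c i})"

definition beta0 :: real where
  "beta0 = 0.50057"

end

theory Submission
  imports Defs "HOL-Computational_Algebra.Polynomial" "HOL-Analysis.Convex" "HOL-Analysis.Harmonic_Numbers"
begin

text \<open>
Write deg for the boundary degree. It suffices to treat the exponent 1/2: since t powr (2 *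
\<beta>) is convex for \<beta> \<ge> 1/2, the power mean inequality passes from sqrt deg to deg
powr \<beta>, without loss on subcubes, where deg is constant.

For the exponent 1/2 the proof is an induction on the dimension. A coordinate splits A into two
slices of measures x \<le> y in the cube of one dimension less. Every boundary edge inside a
slice survives, and each point of the larger slice that is missing from the smaller one gains an
edge; these points have measure at least y - x. Let b be the mean of sqrt deg for the larger
slice before this gain, and u the measure of the points that gain. Two estimates bound the mean
after the gain from below. The triangle inequality for the plane vectors (sqrt deg, 0) and (sqrt
deg, 1) gives sqrt (b^2 + u^2), and sqrt (deg + 1) \<ge> 1 + (sqrt 2 - 1) * sqrt deg, valid
because deg is a natural number, gives (sqrt 2 - 1) * b + u. The maximum of the two is called
lift b u. Hence the mean of sqrt deg is at least B applied to the measure of A for every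
nonnegative function B that vanishes at 0 and 1 and satisfies the two-point inequality 2 * B ((x
+ y) / 2) \<le> B x + lift (B y) (y - x) for 0 \<le> x \<le> y \<le> 1.

The real content is a function B, called bell below, that satisfies this and dominates the
entropy profile x * sqrt (log 2 (1 / x)) on [0, 1/2]. Three pieces are used. On [0, 1/4] it is
the entropy profile itself. On [1/4, 1/2] it is the quadratic x * (1 + 2 * (sqrt 2 - 1) * (1 - 2
* x)): sqrt (log 2 (1 / x)) is replaced by its linear interpolation between 1/4 and 1/2. On
[1/2, 1] it is a polynomial of degree 7. The constraints leave little room. For close points x,
y one needs B * B'' \<ge> -2 and no concave kink, so that the derivative to the right of 1/2
must be at least the derivative of the quadratic to the left; the chord bound for x = 0 with y
\<ge> 1/2 needs B y \<ge> 2 * y * (1 - y); and B 1 = 0. The solutions of B * B'' = - c are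
Gaussian isoperimetric profiles, and the polynomial imitates the one with c slightly below 2
that fits these boundary values.

The two-point inequality is proved in the coordinate w = 2 * x - 1, in which y - x is half of
the distance of the two points and is called h. Fix the midpoint. When lift is replaced by one
of its linear minorants, the right side is concave in h, so it is enough to check the two ends
of an interval of values of h, which leaves an inequality in one variable. This settles most
pairs that are not close; far pairs use the minorant (sqrt 2 - 1) * b + u. For close pairs the
linear minorant must follow the direction of (b, u): it is tangent to the norm at a point whose
slope is roughly proportional to h, and after division by h^2 a few values of h are again
enough. When the midpoint is below 1/2 and the larger slice above it, the second difference of
the quadratic is constant, and the norm bound becomes a condition that is convex in h^2. If both
points are at most 1/2, the quadratic and the entropy profile are treated by hand; the latter
rests on two elementary bounds of the logarithm. The polynomial inequalities in one variable are
proved from the coefficients by a Horner scheme with bisection.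
\<close>

section \<open>Polynomials that are nonnegative on an interval\<close>

text \<open>
Evaluate Horner's scheme on [0, 1] from the inside out, replacing each partial value r in c + t
* r by min 0 r; this is a lower bound since t \<in> [0, 1].
\<close>

definition horner_bound :: "real poly \<Rightarrow> real" where
  "horner_bound p = foldr (\<lambda>c r. c + min 0 r) (coeffs p) 0"

lemma horner_bound_0 [simp]: "horner_bound 0 = 0"
  by (simp add: horner_bound_def)

lemma horner_bound_pCons [simp]: "horner_bound (pCons c p) = c + min 0 (horner_bound p)"
  by (cases "c = 0 \<and> p = 0") (auto simp: horner_bound_def cCons_def)

lemma horner_bound_le_poly:
  assumes "0 \<le> t" "t \<le> 1"
  shows "horner_bound p \<le> poly p t"
proof (induction p)
  case (pCons c p)
  have "min 0 (horner_bound p) \<le> t * min 0 (horner_bound p)"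
    using assms by (simp add: min_def mult_left_le_one_le mult_le_cancel_right1)
  also have "\<dots> \<le> t * poly p t"
    using pCons assms by (intro mult_left_mono) auto
  finally show ?case by simp
qed simp

text \<open>
On a short interval the coefficients above the constant one become small, so the Horner bound
comes close to the constant coefficient; halving therefore succeeds for every polynomial that is
strictly positive on [0, 1].
\<close>

fun bisection_nonneg :: "nat \<Rightarrow> real poly \<Rightarrow> bool" where
  "bisection_nonneg 0 p = (0 \<le> horner_bound p)"
| "bisection_nonneg (Suc k) p =
     (if 0 \<le> horner_bound p then True
      else bisection_nonneg k (p \<circ>\<^sub>p [:0, 1/2:]) \<and> bisection_nonneg k (p \<circ>\<^sub>p [:1/2, 1/2:]))"

lemma bisection_nonneg_numeral [simp]:
  "bisection_nonneg (numeral k) p =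
     (if 0 \<le> horner_bound p then True
      else bisection_nonneg (pred_numeral k) (p \<circ>\<^sub>p [:0, 1/2:]) \<and>
           bisection_nonneg (pred_numeral k) (p \<circ>\<^sub>p [:1/2, 1/2:]))"
  by (simp add: numeral_eq_Suc)

lemma bisection_nonneg_imp:
  assumes "bisection_nonneg k p" "0 \<le> t" "t \<le> 1"
  shows "0 \<le> poly p t"
  using assms
proof (induction k arbitrary: p t)
  case 0
  then show ?case using horner_bound_le_poly[of t p] by simp
next
  case (Suc k)
  show ?case
  proof (cases "0 \<le> horner_bound p")
    case True
    then show ?thesis using horner_bound_le_poly[of t p] Suc.prems by simp
  next
    case False
    then have halves: "bisection_nonneg k (p \<circ>\<^sub>p [:0, 1/2:])" "bisection_nonneg k (p \<circ>\<^sub>p [:1/2, 1/2:])"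
      using Suc.prems(1) by auto
    show ?thesis
    proof (cases "t \<le> 1/2")
      case True
      then show ?thesis using Suc.IH[OF halves(1), of "2 * t"] Suc.prems by (simp add: poly_pcompose)
    next
      case False
      moreover have "1/2 + (2 * t - 1) / 2 = t" by (simp add: field_simps)
      ultimately show ?thesis using Suc.IH[OF halves(2), of "2 * t - 1"] Suc.prems by (simp add: poly_pcompose)
    qed
  qed
qed

text \<open>
At most four successive bisections are enough for all polynomials below. The hypothesis is
decided by arithmetic on the coefficients.
\<close>

lemma poly_nonneg_on_interval:
  assumes "a \<le> x" "x \<le> b" "bisection_nonneg 4 (p \<circ>\<^sub>p [:a, b - a:])"
  shows "0 \<le> poly p x"
proof -
  define t where "t = (if a = b then 0 else (x - a) / (b - a))"
  have "a + t * (b - a) = x" "0 \<le> t" "t \<le> 1"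
    using assms by (auto simp: t_def field_simps)
  with bisection_nonneg_imp[OF assms(3), of t] show ?thesis
    by (simp add: poly_pcompose)
qed

section \<open>The gain from splitting along a coordinate\<close>

text \<open>
The slope of the chord of s \<mapsto> sqrt (s^2 + 1) between s = 0 and s = 1.
\<close>

definition kap :: real where "kap = sqrt 2 - 1"

lemma kap_sq: "kap^2 = 1 - 2 * kap"
  by (simp add: kap_def power2_eq_square algebra_simps)

lemma kap_bounds: "0.4142 \<le> kap" "kap \<le> 0.41422"
proof -
  have "1.4142 \<le> sqrt 2" by (rule real_le_rsqrt) (simp add: power2_eq_square)
  moreover have "sqrt 2 \<le> 1.41422" by (rule real_le_lsqrt) (simp_all add: power2_eq_square)
  ultimately show "0.4142 \<le> kap" "kap \<le> 0.41422" by (auto simp: kap_def)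
qed

text \<open>
The first entry of the maximum is the better one when b is large compared with u, the second one
when it is not.
\<close>

definition lift :: "real \<Rightarrow> real \<Rightarrow> real" where
  "lift b u = max (sqrt (b^2 + u^2)) (kap * b + u)"

lemma lift_ge_chord: "kap * b + u \<le> lift b u" and lift_ge_norm: "sqrt (b^2 + u^2) \<le> lift b u"
  by (auto simp: lift_def)

text \<open>
The supporting lines of the Euclidean norm.
\<close>

lemma lift_ge_line:
  assumes "c^2 + s^2 = 1"
  shows "c * b + s * u \<le> lift b u"
proof -
  have "(c * b + s * u)^2 + (s * b - c * u)^2 = (c^2 + s^2) * (b^2 + u^2)"
    by (simp add: power2_eq_square algebra_simps)
  then have "(c * b + s * u)^2 \<le> b^2 + u^2"
    unfolding assms mult_1 using zero_le_power2[of "s * b - c * u"] by linarith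
  then have "c * b + s * u \<le> sqrt (b^2 + u^2)"
    by (rule real_le_rsqrt)
  then show ?thesis using lift_ge_norm[of b u] by linarith
qed

lemma lift_mono:
  assumes "0 \<le> b" "b \<le> b'" "0 \<le> u" "u \<le> u'"
  shows "lift b u \<le> lift b' u'"
proof -
  have "sqrt (b^2 + u^2) \<le> sqrt (b'^2 + u'^2)"
    using assms by (intro real_sqrt_le_mono add_mono power_mono) auto
  moreover have "kap * b + u \<le> kap * b' + u'"
    using assms kap_bounds by (intro add_mono mult_left_mono) auto
  ultimately show ?thesis unfolding lift_def by linarith
qed

text \<open>
The supporting line at the angle whose half has tangent q * h. The optimal angle has tangent h /
b, so for small h the best q is 1 / (2 * b); a constant q close to that value keeps the error of
order h^2 * (q - 1 / (2 * b))^2.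
\<close>

lemma two_point_from_tangent:
  assumes "0 \<le> (1 + (q*h)^2) * (a - 2 * c) + (1 - (q*h)^2) * b + 2 * q * h^2"
  shows "2 * c \<le> a + lift b h"
proof -
  let ?s = "q * h" and ?d = "1 + (q*h)^2"
  have d: "0 < ?d" by (simp add: add_pos_nonneg)
  have "((1 - ?s^2) / ?d)^2 + (2 * ?s / ?d)^2 = ((1 - ?s^2)^2 + (2 * ?s)^2) / ?d^2"
    by (simp add: power_divide add_divide_distrib)
  also have "(1 - ?s^2)^2 + (2 * ?s)^2 = ?d^2"
    by (simp add: power2_eq_square algebra_simps)
  finally have "(1 - ?s^2) / ?d * b + 2 * ?s / ?d * h \<le> lift b h"
    using d by (intro lift_ge_line) auto
  then have "?d * ((1 - ?s^2) / ?d * b + 2 * ?s / ?d * h) \<le> ?d * lift b h"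
    using d by simp
  also have "?d * ((1 - ?s^2) / ?d * b + 2 * ?s / ?d * h) = (1 - ?s^2) * b + 2 * q * h^2"
    using d by (simp add: divide_simps power2_eq_square del: power_mult_distrib)
  finally have "0 \<le> ?d * (a - 2 * c + lift b h)"
    using assms by (simp add: algebra_simps)
  then show ?thesis using d by (simp add: zero_le_mult_iff)
qed

lemma lift_scale:
  assumes "0 \<le> k" shows "lift (k * b) (k * u) = k * lift b u"
proof -
  have "sqrt ((k * b)^2 + (k * u)^2) = k * sqrt (b^2 + u^2)"
    using assms by (simp add: power_mult_distrib real_sqrt_mult flip: distrib_left)
  then show ?thesis unfolding lift_def using assms by (simp add: max_mult_distrib_left algebra_simps)
qed

section \<open>The profile functions\<close>

text \<open>
The upper piece of the Bellman function in the centred coordinate w = 2 * x - 1 \<in> [0, 1].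
The factor 1 - w makes it vanish at the full cube. The coefficient 1.1716 is just above 2 - 2 *
kap, so the derivative at 0, 0.0858, is just above that of the quadratic piece. The other
coefficients were chosen so that the product with the second derivative stays above - 1/2 on [0,
1], which is the condition B * B'' \<ge> -2 in the coordinate x.
\<close>

definition prof_poly :: "real poly" where
  "prof_poly = [:1/2, -1/2:] * [:1, 1.1716, 0.186, 0.29, 0, 0, 0.36:]"

definition prof :: "real \<Rightarrow> real" where "prof w = poly prof_poly w"

lemma prof_expand:
  "2 * prof w = 1 + 0.1716 * w - 0.9856 * w^2 + 0.104 * w^3 - 0.29 * w^4 + 0.36 * w^6 - 0.36 * w^7"
  unfolding prof_def prof_poly_def by (simp add: algebra_simps power_numeral_reduce)

text \<open>
The middle piece in the centred coordinate. At measure x it equals half of kap * b + u for u = 2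
* x and b = 2 * u * (1 - u): an empty slice against a slice of measure u with a parabolic
profile.
\<close>

definition quad :: "real \<Rightarrow> real" where "quad w = (1 + w) * (1 - 2 * kap * w) / 2"

definition quad_poly :: "real \<Rightarrow> real poly" where
  "quad_poly k = smult (1/2) ([:1, 1:] * [:1, - 2 * k:])"

lemma poly_quad_poly: "poly (quad_poly k) w = (1 + w) * (1 - 2 * k * w) / 2"
  by (simp add: quad_poly_def algebra_simps)

lemma quad_ge:
  assumes "-1 \<le> w" "w \<le> 0"
  shows "poly (quad_poly 0.4142) w \<le> quad w"
proof -
  have "0 \<le> (kap - 0.4142) * ((1 + w) * (- w))"
    using assms kap_bounds by (intro mult_nonneg_nonneg) auto
  then show ?thesis unfolding quad_def poly_quad_poly by (simp add: field_simps)
qed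

lemma quad_le:
  assumes "-1 \<le> w" "w \<le> 0"
  shows "quad w \<le> poly (quad_poly 0.41422) w"
proof -
  have "0 \<le> (0.41422 - kap) * ((1 + w) * (- w))"
    using assms kap_bounds by (intro mult_nonneg_nonneg) auto
  then show ?thesis unfolding quad_def poly_quad_poly by (simp add: field_simps)
qed

lemma prof_concave: "concave_on {0..1} prof"
proof (rule f''_le0_imp_concave)
  let ?p' = "pderiv prof_poly"
  show "DERIV prof w :> poly ?p' w" for w
    unfolding prof_def[abs_def] by (rule poly_DERIV)
  show "DERIV (poly ?p') w :> poly (pderiv ?p') w" for w
    by (rule poly_DERIV)
  fix w :: real assume "w \<in> {0..1}"
  then have "0 \<le> poly (- pderiv ?p') w"
    by (intro poly_nonneg_on_interval[where a = 0 and b = 1])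
       (simp_all add: prof_poly_def pderiv_pCons pcompose_pCons)
  then show "poly (pderiv ?p') w \<le> 0" by simp
qed simp

lemma quad_concave: "concave_on UNIV quad"
proof (rule f''_le0_imp_concave)
  show "DERIV quad w :> (1 - 2 * kap - 4 * kap * w) / 2" for w
    unfolding quad_def[abs_def] by (auto intro!: derivative_eq_intros simp: field_simps)
  show "DERIV (\<lambda>w. (1 - 2 * kap - 4 * kap * w) / 2) w :> - 2 * kap" for w
    by (auto intro!: derivative_eq_intros)
qed (use kap_bounds in auto)

lemma prof_nonneg:
  assumes "0 \<le> w" "w \<le> 1"
  shows "0 \<le> prof w"
  unfolding prof_def using assms
  by (rule poly_nonneg_on_interval) (simp add: prof_poly_def pcompose_pCons)

text \<open>
A quadratic has a constant second difference. With the midpoint m, the two-point inequality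
becomes a statement about the single point m + h and h^2.
\<close>

lemma quad_identity: "2 * quad m - quad (m - h) = quad (m + h) + 2 * kap * h^2"
  by (simp add: quad_def power2_eq_square field_simps)

lemma times_log2_inverse_nonneg: "0 \<le> x \<Longrightarrow> x \<le> 1 \<Longrightarrow> 0 \<le> x * log 2 (1 / x)"
  by (cases "x = 0") auto

definition ent :: "real \<Rightarrow> real" where "ent x = x * sqrt (log 2 (1 / x))"

lemma ent_nonneg: "0 \<le> x \<Longrightarrow> x \<le> 1 \<Longrightarrow> 0 \<le> ent x"
  by (cases "x = 0") (auto simp: ent_def)

lemma ent_0 [simp]: "ent 0 = 0" by (simp add: ent_def)

lemma ent_sq: "0 \<le> x \<Longrightarrow> x \<le> 1 \<Longrightarrow> (ent x)^2 = x^2 * log 2 (1 / x)"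
  by (cases "x = 0") (auto simp: ent_def power_mult_distrib)

text \<open>
The tangent at z of the entropy function x * log 2 (1 / x).
\<close>

lemma log2_inverse_le_tangent:
  assumes "0 \<le> x" "0 < z"
  shows "x * log 2 (1 / x) \<le> x * log 2 (1 / z) + (z - x) / ln 2"
proof (cases "x = 0")
  case False
  then have x: "0 < x" using assms by simp
  have "x * ln (z / x) \<le> x * (z / x - 1)"
    using x assms by (intro mult_left_mono ln_le_minus_one) auto
  also have "\<dots> = z - x" using x by (simp add: field_simps)
  finally have "x * (ln (1 / x) - ln (1 / z)) \<le> z - x"
    using x assms by (simp add: ln_div)
  then have "x * (ln (1 / x) - ln (1 / z)) / ln 2 \<le> (z - x) / ln 2"
    by (intro divide_right_mono) auto
  then show ?thesis by (simp add: log_def right_diff_distrib diff_divide_distrib)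
qed (use assms in simp)

text \<open>
It is the geometric mean of the concave functions x and x * log 2 (1 / x), and the geometric
mean is concave by the Cauchy-Schwarz inequality.
\<close>

lemma ent_concave: "concave_on {0..1} ent"
proof (rule concave_on_linorderI)
  fix t x y :: real assume t: "0 < t" "t < 1" and "x \<in> {0..1}" "y \<in> {0..1}" "x < y"
  then have xy: "0 \<le> x" "x < y" "y \<le> 1" by auto
  define z where "z = (1 - t) * x + t * y"
  have z: "0 < z" "z \<le> 1"
    using t xy convex_bound_le[of x 1 y "1 - t" t] by (auto simp: z_def add_nonneg_pos)
  let ?a = "x * log 2 (1 / x)" and ?b = "y * log 2 (1 / y)"
  have ab: "0 \<le> ?a" "0 \<le> ?b"
    using xy by (intro times_log2_inverse_nonneg; simp)+
  have "(1 - t) * ?a + t * ?b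
      \<le> (1 - t) * (x * log 2 (1 / z) + (z - x) / ln 2) + t * (y * log 2 (1 / z) + (z - y) / ln 2)"
    using t xy z by (intro add_mono mult_left_mono log2_inverse_le_tangent) auto
  also have "\<dots> = ((1 - t) * x + t * y) * log 2 (1 / z) + (z - ((1 - t) * x + t * y)) / ln 2"
    unfolding divide_inverse[of _ "ln 2"] by algebra
  also have "(1 - t) * x + t * y = z" by (simp add: z_def)
  finally have tangent: "(1 - t) * ?a + t * ?b \<le> z * log 2 (1 / z)" by simp
  define p q c d where "p = sqrt x" and "q = sqrt y" and "c = sqrt ?a" and "d = sqrt ?b"
  have squares: "p^2 = x" "q^2 = y" "c^2 = ?a" "d^2 = ?b"
    using xy ab by (auto simp: p_def q_def c_def d_def)
  have ent_eq: "ent w = sqrt w * sqrt (w * log 2 (1 / w))" if "0 \<le> w" for w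
    using that by (simp add: ent_def real_sqrt_mult)
  have "((1 - t) * (p * c) + t * (q * d))^2
      = ((1 - t) * p^2 + t * q^2) * ((1 - t) * c^2 + t * d^2) - (1 - t) * t * (p * d - q * c)^2"
    by algebra
  also have "\<dots> \<le> z * ((1 - t) * ?a + t * ?b)"
    using t unfolding squares z_def by simp
  also have "\<dots> \<le> z * (z * log 2 (1 / z))"
    using tangent z by (intro mult_left_mono) auto
  finally have "(1 - t) * (p * c) + t * (q * d) \<le> sqrt (z * (z * log 2 (1 / z)))"
    by (rule real_le_rsqrt)
  moreover have "ent x = p * c" "ent y = q * d" "ent z = sqrt (z * (z * log 2 (1 / z)))"
    using xy z ent_eq by (simp_all only: p_def q_def c_def d_def real_sqrt_mult)
  moreover have "(1 - t) *\<^sub>R x + t *\<^sub>R y = z" by (simp add: z_def)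
  ultimately show "(1 - t) * ent x + t * ent y \<le> ent ((1 - t) *\<^sub>R x + t *\<^sub>R y)"
    by simp
qed simp

lemma quad_real: "quad (2 * x - 1) = x * (1 + 2 * kap * (1 - 2 * x))"
  by (simp add: quad_def field_simps)

text \<open>
After division by x, both sides agree at 1/4 and 1/2, where log 2 (1 / x) is 2 and 1. The
difference \<phi> of their squares is convex, so it is nonpositive between its two zeros and
nonnegative to the left of 1/4.
\<close>

lemma ent_quad_compare:
  shows "0 \<le> x \<Longrightarrow> x \<le> 1/4 \<Longrightarrow> quad (2 * x - 1) \<le> ent x"
    and "1/4 \<le> x \<Longrightarrow> x \<le> 1/2 \<Longrightarrow> ent x \<le> quad (2 * x - 1)"
proof -
  define \<phi> where "\<phi> x = log 2 (1 / x) - (1 + 2 * kap * (1 - 2 * x))^2" for x :: real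
  have "convex_on {0<..1/2} \<phi>"
  proof (rule f''_ge0_imp_convex)
    fix x :: real assume "x \<in> {0<..1/2}"
    then have x: "0 < x" "x \<le> 1/2" by auto
    have "((\<lambda>x. - ln x / ln 2 - (1 + 2 * kap * (1 - 2 * x))^2)
        has_real_derivative (- (1 / x) / ln 2 + 8 * kap * (1 + 2 * kap * (1 - 2 * x)))) (at x)"
      using x by (auto intro!: derivative_eq_intros)
    moreover have "\<forall>\<^sub>F y in nhds x. \<phi> y = - ln y / ln 2 - (1 + 2 * kap * (1 - 2 * y))^2"
      using eventually_nhds_in_open[of "{0<..}" x] x
      by (auto elim!: eventually_mono simp: \<phi>_def log_def ln_div)
    ultimately show "(\<phi> has_real_derivative (- (1 / x) / ln 2 + 8 * kap * (1 + 2 * kap * (1 - 2 * x)))) (at x)"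
      by (subst DERIV_cong_ev[OF refl _ refl])
    show "((\<lambda>x. - (1 / x) / ln 2 + 8 * kap * (1 + 2 * kap * (1 - 2 * x)))
        has_real_derivative (1 / (x^2 * ln 2) - 32 * kap^2)) (at x)"
      using x by (auto intro!: derivative_eq_intros simp: power2_eq_square)
    have "x^2 * ln 2 \<le> (1/2)^2 * (25/36)"
      using x ln2_le_25_over_36 by (intro mult_mono power_mono) auto
    then have "1 / ((1/2)^2 * (25/36)) \<le> 1 / (x^2 * ln 2)"
      using x by (intro divide_left_mono) auto
    moreover have "32 * kap^2 \<le> 32 * 0.41422^2"
      using kap_bounds by (intro mult_left_mono power_mono) auto
    ultimately show "0 \<le> 1 / (x^2 * ln 2) - 32 * kap^2"
      by (simp add: power2_eq_square)
  qed simp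
  then have conv: "\<phi> ((1 - t) * x + t * y) \<le> (1 - t) * \<phi> x + t * \<phi> y"
    if "0 \<le> t" "t \<le> 1" "0 < x" "x \<le> 1/2" "0 < y" "y \<le> 1/2" for t x y
    using convex_onD[of "{0<..1/2}" \<phi> t x y] that by simp
  have log4: "log 2 (4::real) = 2" using log_nat_power[of 2 2 2] by simp
  have zeros: "\<phi> (1/4) = 0" "\<phi> (1/2) = 0"
    using kap_sq by (simp_all add: \<phi>_def log4 power2_eq_square algebra_simps)
  have pos: "0 \<le> \<phi> x" if "0 < x" "x \<le> 1/4" for x
  proof -
    define t where "t = (1/4 - x) / (1/2 - x)"
    have t: "0 \<le> t" "t < 1" using that by (auto simp: t_def field_simps)
    have "t * (1/2 - x) = 1/4 - x" using that by (simp add: t_def)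
    then have eq: "(1 - t) * x + t * (1/2) = 1/4" by (simp add: algebra_simps)
    have "0 \<le> (1 - t) * \<phi> x"
      using conv[of t x "1/2", unfolded eq] t that zeros by simp
    then show ?thesis using t by (simp add: zero_le_mult_iff)
  qed
  have neg: "\<phi> x \<le> 0" if "1/4 \<le> x" "x \<le> 1/2" for x
    using conv[of "4 * x - 1" "1/4" "1/2"] that zeros by (simp add: field_simps)
  show "quad (2 * x - 1) \<le> ent x" if x: "0 \<le> x" "x \<le> 1/4"
  proof (cases "x = 0")
    case False
    then have "(1 + 2 * kap * (1 - 2 * x))^2 \<le> log 2 (1 / x)"
      using pos[of x] x by (simp add: \<phi>_def)
    then have "1 + 2 * kap * (1 - 2 * x) \<le> sqrt (log 2 (1 / x))"
      by (rule real_le_rsqrt)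
    then show ?thesis unfolding quad_real ent_def using x by (intro mult_left_mono)
  qed (simp add: quad_def)
  show "ent x \<le> quad (2 * x - 1)" if x: "1/4 \<le> x" "x \<le> 1/2"
  proof -
    have "log 2 (1 / x) \<le> (1 + 2 * kap * (1 - 2 * x))^2"
      using neg[of x] x by (simp add: \<phi>_def)
    then have "sqrt (log 2 (1 / x)) \<le> 1 + 2 * kap * (1 - 2 * x)"
      using x kap_bounds by (intro real_le_lsqrt) auto
    then show ?thesis unfolding quad_real ent_def using x by (intro mult_left_mono) auto
  qed
qed

section \<open>Comparing a midpoint with its two neighbours\<close>

text \<open>
For a fixed midpoint m the bound obtained from a line minorant of lift is concave in the half-
distance h.
\<close>

lemma concave_two_point_between:
  fixes f g :: "real \<Rightarrow> real"
  assumes f: "concave_on I f" and g: "concave_on J g" and "0 \<le> k"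
    and h: "h0 \<le> h" "h \<le> h1"
    and I: "m - h0 \<in> I" "m - h1 \<in> I" and J: "m + h0 \<in> J" "m + h1 \<in> J"
    and ends: "c \<le> f (m - h0) + k * g (m + h0) + s * h0" "c \<le> f (m - h1) + k * g (m + h1) + s * h1"
  shows "c \<le> f (m - h) + k * g (m + h) + s * h"
proof -
  obtain t where t: "0 \<le> t" "t \<le> 1" "h = (1 - t) * h0 + t * h1"
  proof (cases "h0 = h1")
    case True
    then show ?thesis using h that[of 0] by simp
  next
    case False
    define t where "t = (h - h0) / (h1 - h0)"
    have "t * (h1 - h0) = h - h0" using False by (simp add: t_def)
    then have "h = (1 - t) * h0 + t * h1" by (simp add: algebra_simps)
    moreover have "0 \<le> t" "t \<le> 1" using h False by (auto simp: t_def divide_simps)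
    ultimately show ?thesis using that by blast
  qed
  have "m - h = (1 - t) *\<^sub>R (m - h0) + t *\<^sub>R (m - h1)" "m + h = (1 - t) *\<^sub>R (m + h0) + t *\<^sub>R (m + h1)"
    by (simp_all add: t algebra_simps)
  then have "(1 - t) * f (m - h0) + t * f (m - h1) \<le> f (m - h)"
    and "(1 - t) * g (m + h0) + t * g (m + h1) \<le> g (m + h)"
    using concave_onD[OF f, of t "m - h0" "m - h1"] concave_onD[OF g, of t "m + h0" "m + h1"] t I J
    by auto
  moreover from this have "k * ((1 - t) * g (m + h0) + t * g (m + h1)) \<le> k * g (m + h)"
    using \<open>0 \<le> k\<close> by (intro mult_left_mono)
  moreover have "(1 - t) * c + t * c \<le> (1 - t) * (f (m - h0) + k * g (m + h0) + s * h0) + t * (f (m - h1) + k * g (m + h1) + s * h1)"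
    using ends t by (intro add_mono mult_left_mono) auto
  ultimately show ?thesis by (simp add: t algebra_simps)
qed

section \<open>Both points below one half\<close>

lemma ln_ge_pade:
  assumes "1 \<le> z" shows "2 * (z - 1) / (z + 1) \<le> ln (z::real)"
proof -
  have "ln 1 - 2 * (1 - 1) / (1 + 1) \<le> ln z - 2 * (z - 1) / (z + 1)"
  proof (rule DERIV_nonneg_imp_nondecreasing[OF assms])
    fix t :: real assume t: "1 \<le> t" "t \<le> z"
    have "((\<lambda>t. ln t - 2 * (t - 1) / (t + 1)) has_real_derivative
        (1 / t - (2 * (t + 1) - 2 * (t - 1)) / ((t + 1) * (t + 1)))) (at t)"
      using t by (auto intro!: derivative_eq_intros)
    moreover have "1 / t - (2 * (t + 1) - 2 * (t - 1)) / ((t + 1) * (t + 1)) = (t - 1)^2 / (t * (t + 1)^2)"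
      using t by (simp add: divide_simps power2_eq_square) (simp add: algebra_simps)
    ultimately show "\<exists>y. ((\<lambda>t. ln t - 2 * (t - 1) / (t + 1)) has_real_derivative y) (at t) \<and> 0 \<le> y"
      using t by (intro exI conjI) auto
  qed
  then show ?thesis by simp
qed

lemma ln_le_half_difference:
  assumes "1 \<le> z" shows "ln (z::real) \<le> (z - 1 / z) / 2"
proof -
  have "(1 - 1 / 1) / 2 - ln 1 \<le> (z - 1 / z) / 2 - ln z"
  proof (rule DERIV_nonneg_imp_nondecreasing[OF assms])
    fix t :: real assume t: "1 \<le> t" "t \<le> z"
    have "((\<lambda>t. (t - 1 / t) / 2 - ln t) has_real_derivative ((1 + 1 / (t * t)) / 2 - 1 / t)) (at t)"
      using t by (auto intro!: derivative_eq_intros)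
    moreover have "(1 + 1 / (t * t)) / 2 - 1 / t = (t - 1)^2 / (2 * t^2)"
      using t by (simp add: divide_simps power2_eq_square) (simp add: algebra_simps)
    ultimately show "\<exists>y. ((\<lambda>t. (t - 1 / t) / 2 - ln t) has_real_derivative y) (at t) \<and> 0 \<le> y"
      using t by (intro exI conjI) auto
  qed
  then show ?thesis by simp
qed

lemma sqrt_lower_pade:
  assumes "0 \<le> z" shows "1 + 2 * z / (4 + z) \<le> sqrt (1 + z)"
proof (rule real_le_rsqrt)
  have "(4 + 3 * z)^2 \<le> (1 + z) * (4 + z)^2"
    using assms by (simp add: power2_eq_square algebra_simps)
  then have "((4 + 3 * z) / (4 + z))^2 \<le> 1 + z"
    using assms by (simp add: power_divide divide_simps)
  also have "(4 + 3 * z) / (4 + z) = 1 + 2 * z / (4 + z)"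
    using assms by (simp add: field_simps)
  finally show "(1 + 2 * z / (4 + z))^2 \<le> 1 + z" .
qed

lemma sqrt_lower_pade_neg:
  assumes "0 \<le> z" "z \<le> 1" shows "1 - z / (2 - z) \<le> sqrt (1 - z)"
proof (rule real_le_rsqrt)
  have "(2 - 2 * z)^2 = (1 - z) * (4 * (1 - z))"
    by (simp add: power2_eq_square algebra_simps)
  also have "\<dots> \<le> (1 - z) * (2 - z)^2"
    using assms by (intro mult_left_mono) (auto simp: power2_eq_square algebra_simps)
  finally have "((2 - 2 * z) / (2 - z))^2 \<le> 1 - z"
    using assms by (simp add: power_divide divide_simps)
  also have "(2 - 2 * z) / (2 - z) = 1 - z / (2 - z)"
    using assms by (simp add: field_simps)
  finally show "(1 - z / (2 - z))^2 \<le> 1 - z" .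
qed

lemma log2_div: "0 < a \<Longrightarrow> 0 < b \<Longrightarrow> log 2 (a / b) = log 2 a - log 2 (b::real)"
  by (simp add: log_divide)

text \<open>
Write l for log 2 (1 / m) with m the midpoint of r * y and y; then log 2 of the inverses of the
two points are l + d and l - e - (1 - r)^2. To leading order for large l the two-point
inequality reads r * d \<ge> e, and this lemma controls the correction. At r = 1 both d and e
vanish to first order with the same coefficient, so the bounds of the logarithm must be exact to
second order there; for small r crude bounds are enough.
\<close>

lemma entropy_gap:
  assumes r: "0 < r" "r \<le> 1"
  defines "d \<equiv> log 2 ((1 + r) / (2 * r))" and "e \<equiv> log 2 (2 / (1 + r)) - (1 - r)^2"
  assumes e: "0 \<le> e"
  shows "d * e * (r + 1/2) \<le> 4 * (r * d - e)"
proof -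
  have ln2: "2/3 \<le> ln (2::real)" "0 < ln (2::real)" using ln2_ge_two_thirds by auto
  have "log 2 (2 / (1 + r)) \<le> 1 - r"
  proof -
    have "(1 - r) * log 2 1 + r * log 2 2 \<le> log 2 ((1 - r) *\<^sub>R 1 + r *\<^sub>R 2)"
      using r log_concave[of 2] by (intro concave_onD[of "{0<..}"]) auto
    then have "r \<le> log 2 (1 + r)" by (simp add: algebra_simps)
    then show ?thesis using r by (simp add: log2_div)
  qed
  then have e_le: "e \<le> r * (1 - r)"
    by (simp add: e_def power2_eq_square algebra_simps)
  show ?thesis
  proof (cases "r \<le> 1/5")
    case True
    have "3 * ln 2 = ln ((2::real)^3)" by (subst ln_realpow) auto
    also have "\<dots> \<le> ln (((1 + r) / (2 * r))^2)"
    proof (subst ln_le_cancel_iff)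
      have "3^2 \<le> ((1 + r) / (2 * r))^2"
        using r True by (intro power_mono) (auto simp: field_simps)
      then show "2^3 \<le> ((1 + r) / (2 * r))^2" by simp
    qed (use r in auto)
    also have "\<dots> = 2 * ln ((1 + r) / (2 * r))" using r by (simp add: ln_realpow)
    finally have d: "3/2 \<le> d" by (simp add: d_def log_def pos_le_divide_eq)
    have "e * (4 + d * (r + 1/2)) \<le> r * (1 - r) * (4 + d * (r + 1/2))"
      using e_le r d by (intro mult_right_mono) auto
    also have "\<dots> = r * (4 * d - ((4 - (1 - r) * (r + 1/2)) * (d - 3/2) + (5/4 + (13/4) * r + (3/2) * r^2)))"
      by (simp add: power2_eq_square field_simps)
    also have "\<dots> \<le> r * (4 * d - 0)"
    proof (intro mult_left_mono diff_left_mono)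
      have "(1 - r) * (r + 1/2) \<le> 1 * 2" using r by (intro mult_mono) auto
      then have "0 \<le> (4 - (1 - r) * (r + 1/2)) * (d - 3/2)"
        using d by (intro mult_nonneg_nonneg) linarith+
      moreover have "0 \<le> r^2" by simp
      ultimately show "0 \<le> (4 - (1 - r) * (r + 1/2)) * (d - 3/2) + (5/4 + (13/4) * r + (3/2) * r^2)"
        using r by linarith
    qed (use r in simp)
    finally show ?thesis by (simp add: algebra_simps)
  next
    case False
    define s where "s = 1 - r"
    have s: "0 \<le> s" "s \<le> 4/5" and rs: "r = 1 - s" using r False by (auto simp: s_def)
    have "r * (2 * ((1 + r) / (2 * r) - 1) / ((1 + r) / (2 * r) + 1)) \<le> r * ln ((1 + r) / (2 * r))"
      using r by (intro mult_left_mono ln_ge_pade) (auto simp: field_simps)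
    moreover have "r * (2 * ((1 + r) / (2 * r) - 1) / ((1 + r) / (2 * r) + 1)) = 2 * r * (1 - r) / (1 + 3 * r)"
      using r by (simp add: divide_simps) (simp add: algebra_simps)
    moreover have "ln (2 / (1 + r)) \<le> (2 / (1 + r) - 1 / (2 / (1 + r))) / 2"
      using r by (intro ln_le_half_difference) (auto simp: field_simps)
    moreover have "(2 / (1 + r) - 1 / (2 / (1 + r))) / 2 = (1 - r) * (3 + r) / (4 * (1 + r))"
      using r by (simp add: divide_simps) (simp add: algebra_simps)
    moreover have "2 * r * (1 - r) / (1 + 3 * r) - (1 - r) * (3 + r) / (4 * (1 + r))
        = - ((1 - r)^2 * (5 * r + 3) / (4 * (1 + r) * (1 + 3 * r)))"
      using r by (simp add: divide_simps power2_eq_square) (simp add: algebra_simps)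
    ultimately have "- ((1 - r)^2 * (5 * r + 3) / (4 * (1 + r) * (1 + 3 * r))) \<le> r * ln ((1 + r) / (2 * r)) - ln (2 / (1 + r))"
      by linarith
    also have "\<dots> = ln 2 * (r * d - (e + (1 - r)^2))"
      by (simp add: d_def e_def log_def algebra_simps)
    finally have low: "- (s^2 * (5 * r + 3) / (4 * (1 + r) * (1 + 3 * r))) \<le> ln 2 * (r * d - (e + s^2))"
      by (simp add: s_def)
    define k where "k = s^2 * (5 * r + 3) / (4 * (1 + r) * (1 + 3 * r))"
    have "s^2 * (1 - 3 * (5 * r + 3) / (8 * (1 + r) * (1 + 3 * r))) = s^2 - 3/2 * k"
      using r by (simp add: k_def divide_simps) (simp add: algebra_simps)
    moreover have "s^2 - 3/2 * k \<le> r * d - e"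
    proof (rule ccontr)
      assume "\<not> ?thesis"
      then have "r * d - (e + s^2) < - (3/2 * k)" by simp
      then have "ln 2 * (r * d - (e + s^2)) < ln 2 * (- (3/2 * k))"
        using ln2 by (intro mult_strict_left_mono)
      moreover have "2/3 * (3/2 * k) \<le> ln 2 * (3/2 * k)"
        using ln2 r by (intro mult_right_mono) (auto simp: k_def)
      ultimately show False using low by (simp add: k_def)
    qed
    ultimately have gap: "s^2 * (1 - 3 * (5 * r + 3) / (8 * (1 + r) * (1 + 3 * r))) \<le> r * d - e"
      by (simp only:)
    have d0: "0 \<le> d" using r by (simp add: d_def)
    have "ln ((1 + r) / (2 * r)) \<le> (1 + r) / (2 * r) - 1"
      using r by (intro ln_le_minus_one) auto
    also have "\<dots> = s / (2 * r)" using r by (simp add: s_def field_simps)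
    also have "\<dots> \<le> 3 * s / (4 * r) * ln 2"
      using mult_left_mono[OF ln2(1), of "3 * s / (4 * r)"] r s by simp
    finally have "d \<le> 3 * s / (4 * r)"
      by (simp add: d_def log_def pos_divide_le_eq)
    then have "d * e \<le> 3 * s / (4 * r) * (r * (1 - r))"
      using e e_le d0 r s by (intro mult_mono) auto
    also have "\<dots> = 3 * s^2 / 4" using r by (simp add: s_def power2_eq_square)
    finally have "d * e * (r + 1/2) \<le> 3 * s^2 / 4 * (r + 1/2)"
      using r by (intro mult_right_mono) auto
    also have "\<dots> = s^2 * (3 * (r + 1/2) / 4)" by simp
    also have "\<dots> \<le> s^2 * (4 * (1 - 3 * (5 * r + 3) / (8 * (1 + r) * (1 + 3 * r))))"
    proof (rule mult_left_mono)
      have "0 \<le> poly [:-3.5, 25, 31.5, -9:] r"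
        using False r by (intro poly_nonneg_on_interval[of "1/5" r 1]) (auto simp: pcompose_pCons)
      then show "3 * (r + 1/2) / 4 \<le> 4 * (1 - 3 * (5 * r + 3) / (8 * (1 + r) * (1 + 3 * r)))"
        using r by (simp add: divide_simps) (simp add: algebra_simps)
    qed simp
    also have "\<dots> = 4 * (s^2 * (1 - 3 * (5 * r + 3) / (8 * (1 + r) * (1 + 3 * r))))"
      by (rule mult.left_commute)
    also have "\<dots> \<le> 4 * (r * d - e)" using gap by (rule mult_left_mono) simp
    finally show ?thesis .
  qed
qed

text \<open>
Both sides are homogeneous up to the logarithms. With the notation of the preceding lemma the
claim is (1 + r) * sqrt l \<le> r * sqrt (l + d) + sqrt (l - e), and the two square roots are
expanded around sqrt l by rational lower bounds. The condition x + y \<le> 1/2 means l \<ge> 2,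
which limits the error of the expansions.
\<close>

lemma ent_two_point:
  assumes x: "0 \<le> x" "x \<le> y" "x + y \<le> 1/2" "y \<le> 1/2"
  shows "2 * ent ((x + y) / 2) \<le> ent x + sqrt ((ent y)^2 + (y - x)^2)"
proof (cases "x = 0")
  case True
  show ?thesis
  proof (cases "y = 0")
    case False
    then have y: "0 < y" "y \<le> 1/2" using x by auto
    have "log 2 (1 / (y / 2)) = log 2 (2 * (1 / y))" by simp
    also have "\<dots> = 1 + log 2 (1 / y)" using y by (subst log_mult) auto
    finally have "2 * ent (y / 2) = sqrt (y^2 * (1 + log 2 (1 / y)))"
      using y by (simp add: ent_def real_sqrt_mult)
    also have "\<dots> = sqrt ((ent y)^2 + y^2)"
      using y by (simp add: ent_sq algebra_simps)
    finally show ?thesis using True by simp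
  qed (use True in simp)
next
  case False
  then have pos: "0 < x" "0 < y" using x by auto
  define r where "r = x / y"
  have r: "0 < r" "r \<le> 1" and xr: "x = r * y" using pos x by (auto simp: r_def)
  define m where "m = (x + y) / 2"
  have m: "m = y * (1 + r) / 2" "0 < m" "m \<le> 1/4" using pos x by (auto simp: m_def xr algebra_simps)
  define l where "l = log 2 (1 / m)"
  define d where "d = log 2 ((1 + r) / (2 * r))"
  define e where "e = log 2 (2 / (1 + r)) - (1 - r)^2"
  have l: "2 \<le> l"
  proof -
    have "log 2 4 \<le> log 2 (1 / m)" using m by (subst log_le_cancel_iff) (auto simp: field_simps)
    moreover have "log 2 (4::real) = 2" using log_nat_power[of 2 2 2] by simp
    ultimately show ?thesis by (simp add: l_def)
  qed
  have inv: "1 / x = 1 / m * ((1 + r) / (2 * r))" "1 / m = 1 / y * (2 / (1 + r))"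
    using pos r by (simp_all add: m(1) xr frac_eq_eq add_nonneg_eq_0_iff algebra_simps)
  have logs: "log 2 (1 / x) = l + d" "log 2 (1 / y) = l - e - (1 - r)^2"
  proof -
    show "log 2 (1 / x) = l + d"
      unfolding inv(1) l_def d_def using m r by (intro log_mult_pos) auto
    have "l = log 2 (1 / y) + log 2 (2 / (1 + r))"
      unfolding l_def inv(2) using pos r by (intro log_mult_pos) auto
    then show "log 2 (1 / y) = l - e - (1 - r)^2" by (simp add: e_def)
  qed
  have d: "0 \<le> d" using r by (simp add: d_def)
  have rhs: "ent x = y * (r * sqrt (l + d))"
    "sqrt ((ent y)^2 + (y - x)^2) = y * sqrt (l - e)"
  proof -
    have "ent x = x * sqrt (l + d)" by (simp add: ent_def logs)
    then show "ent x = y * (r * sqrt (l + d))" by (simp add: xr)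
    have "(ent y)^2 = y^2 * (l - e - (1 - r)^2)"
      using x pos by (simp add: ent_sq logs)
    then have "(ent y)^2 + (y - x)^2 = y^2 * (l - e)"
      by (simp add: xr power2_eq_square algebra_simps)
    then show "sqrt ((ent y)^2 + (y - x)^2) = y * sqrt (l - e)"
      using pos by (simp add: real_sqrt_mult)
  qed
  have "(1 + r) * sqrt l \<le> r * sqrt (l + d) + sqrt (l - e)"
  proof (cases "0 \<le> e")
    case False
    then have "sqrt l \<le> sqrt (l + d)" "sqrt l \<le> sqrt (l - e)" using d by auto
    then have "r * sqrt l + sqrt l \<le> r * sqrt (l + d) + sqrt (l - e)"
      using r by (intro add_mono mult_left_mono) auto
    then show ?thesis by (simp add: algebra_simps)
  next
    case True
    have "log 2 (2 / (1 + r)) \<le> log 2 2" using r by (subst log_le_cancel_iff) (auto simp: field_simps)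
    then have "log 2 (2 / (1 + r)) \<le> 1" by simp
    then have e1: "e \<le> 1" unfolding e_def using zero_le_power2[of "1 - r"] by linarith
    have gap: "d * e * (r + 1/2) \<le> 4 * (r * d - e)"
      using entropy_gap[OF r] True by (simp add: d_def e_def)
    have factor: "sqrt (l + d) = sqrt l * sqrt (1 + d / l)" "sqrt (l - e) = sqrt l * sqrt (1 - e / l)"
      using l by (simp_all add: field_simps flip: real_sqrt_mult)
    have "(e / l) / (2 - e / l) \<le> r * (2 * (d / l) / (4 + d / l))"
    proof -
      have "d * e * (2 * r + 1) \<le> 4 * (r * d - e) * 2" using gap by (simp add: algebra_simps)
      also have "\<dots> \<le> 4 * (r * d - e) * l"
      proof (rule mult_left_mono[OF l])
        have "0 \<le> d * e * (r + 1/2)" using d True r by simp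
        then show "0 \<le> 4 * (r * d - e)" using gap by linarith
      qed
      finally have "e * (4 * l + d) \<le> 2 * r * d * (2 * l - e)" by (simp add: algebra_simps)
      then have "e / (2 * l - e) \<le> 2 * r * d / (4 * l + d)"
        using l d e1 by (simp add: divide_simps algebra_simps)
      moreover have "(e / l) / (2 - e / l) = e / (2 * l - e)" "r * (2 * (d / l) / (4 + d / l)) = 2 * r * d / (4 * l + d)"
        using l by (simp_all add: field_simps)
      ultimately show ?thesis by (simp only:)
    qed
    moreover have "1 + 2 * (d / l) / (4 + d / l) \<le> sqrt (1 + d / l)"
      using d l by (intro sqrt_lower_pade) simp
    then have "r * (1 + 2 * (d / l) / (4 + d / l)) \<le> r * sqrt (1 + d / l)"
      using r by (intro mult_left_mono) auto
    moreover have "1 - (e / l) / (2 - e / l) \<le> sqrt (1 - e / l)"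
      using True e1 l by (intro sqrt_lower_pade_neg) auto
    ultimately have "1 + r \<le> r * sqrt (1 + d / l) + sqrt (1 - e / l)"
      by (simp add: distrib_left)
    then have "sqrt l * (1 + r) \<le> sqrt l * (r * sqrt (1 + d / l) + sqrt (1 - e / l))"
      using l by (intro mult_left_mono) auto
    moreover have "sqrt l * (r * sqrt (1 + d / l) + sqrt (1 - e / l)) = r * sqrt (l + d) + sqrt (l - e)"
      unfolding factor by (simp add: algebra_simps)
    ultimately show ?thesis by (simp add: mult.commute)
  qed
  then have "y * ((1 + r) * sqrt l) \<le> y * (r * sqrt (l + d) + sqrt (l - e))"
    using pos by (intro mult_left_mono) auto
  moreover have "2 * ent ((x + y) / 2) = y * ((1 + r) * sqrt l)"
    unfolding m_def[symmetric] by (simp add: ent_def l_def[symmetric]) (simp add: m(1))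
  ultimately show ?thesis unfolding rhs by (simp add: algebra_simps)
qed

text \<open>
The identity for second differences turns this into 4 * kap * quad v + (2 * kap * h)^2 \<le> 1.
The worst case is an empty slice against a half-cube, where kap^2 = 1 - 2 * kap gives equality.
\<close>

lemma quad_two_point:
  assumes "v \<le> 0" "0 \<le> h" "2 * h \<le> 1 + v"
  shows "2 * quad (v - h) \<le> quad (v - 2 * h) + lift (quad v) h"
proof -
  define s where "s = 1 + v"
  have s: "0 \<le> s" "s \<le> 1" "h \<le> s / 2" and v: "v = s - 1" using assms by (auto simp: s_def)
  have k: "0 \<le> kap" "kap \<le> 1" using kap_bounds by auto
  have "(2 * kap * h)^2 \<le> (2 * kap * (s / 2))^2"
    using assms s k by (intro power_mono mult_left_mono) auto
  then have "4 * kap * quad v + (2 * kap * h)^2 \<le> 2 * kap * s * (1 + 2 * kap - 2 * kap * s) + kap^2 * s^2"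
    by (simp add: quad_def v power2_eq_square field_simps)
  also have "\<dots> = 1 - (1 - s) * (2 * kap * (1 - kap * s) + kap^2 * (1 - s))"
  proof -
    have "kap^2 + 2 * kap - 1 = 0" using kap_sq by simp
    then show ?thesis by algebra
  qed
  also have "\<dots> \<le> 1"
  proof -
    have "kap * s \<le> 1 * 1" using s k by (intro mult_mono) auto
    then show ?thesis using s k by simp
  qed
  finally have "h^2 * (4 * kap * quad v + (2 * kap * h)^2) \<le> h^2 * 1"
    by (intro mult_left_mono) auto
  then have "(quad v + 2 * kap * h^2)^2 \<le> (quad v)^2 + h^2"
    by (simp add: power2_eq_square algebra_simps)
  then have "quad v + 2 * kap * h^2 \<le> sqrt ((quad v)^2 + h^2)"
    by (rule real_le_rsqrt)
  then show ?thesis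
    using quad_identity[of "v - h" h] lift_ge_norm[of "quad v" h] by simp
qed

text \<open>
The square of an affine function of v is convex, and so it remains after subtraction of v.
\<close>

lemma square_minus_between:
  fixes v :: real
  assumes v: "v0 \<le> v" "v \<le> v1" and ends: "(a + b * v0)^2 - v0 \<le> c" "(a + b * v1)^2 - v1 \<le> c"
  shows "(a + b * v)^2 - v \<le> c"
proof (cases "v0 = v1")
  case False
  then have d: "0 < v1 - v0" using v by simp
  have "((a + b * v)^2 - v) * (v1 - v0)
      = ((a + b * v0)^2 - v0) * (v1 - v) + ((a + b * v1)^2 - v1) * (v - v0) - b^2 * ((v - v0) * (v1 - v) * (v1 - v0))"
    by algebra
  also have "\<dots> \<le> c * (v1 - v) + c * (v - v0) - 0"
    using v d ends by (intro diff_mono add_mono mult_right_mono mult_nonneg_nonneg) auto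
  also have "\<dots> = c * (v1 - v0)" by algebra
  finally show ?thesis using d by simp
qed (use v ends in auto)

section \<open>Midpoint above one half, distant points\<close>

text \<open>
The slope 3/4 of this supporting line is close to h / prof (m + h) for h near 0.35 and m near 0,
where the chord bound is too weak.
\<close>

lemma far_mixed_line:
  assumes "0 \<le> m" "m \<le> 0.35" "0.35 \<le> h" "h \<le> 0.43"
  shows "2 * prof m \<le> quad (m - h) + 0.8 * prof (m + h) + 0.6 * h"
proof (rule concave_two_point_between[OF quad_concave prof_concave])
  have "0 \<le> poly (quad_poly 0.4142 \<circ>\<^sub>p [:-0.35, 1:] + smult 0.8 (prof_poly \<circ>\<^sub>p [:0.35, 1:]) + [:0.6 * 0.35:] - smult 2 prof_poly) m"
    by (rule poly_nonneg_on_interval[OF assms(1,2)])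
       (simp add: prof_poly_def quad_poly_def pcompose_pCons)
  then show "2 * prof m \<le> quad (m - 0.35) + 0.8 * prof (m + 0.35) + 0.6 * 0.35"
    using quad_ge[of "m - 0.35"] assms by (simp add: prof_def poly_pcompose add.commute)
  have "0 \<le> poly (quad_poly 0.4142 \<circ>\<^sub>p [:-0.43, 1:] + smult 0.8 (prof_poly \<circ>\<^sub>p [:0.43, 1:]) + [:0.6 * 0.43:] - smult 2 prof_poly) m"
    by (rule poly_nonneg_on_interval[OF assms(1,2)])
       (simp add: prof_poly_def quad_poly_def pcompose_pCons)
  then show "2 * prof m \<le> quad (m - 0.43) + 0.8 * prof (m + 0.43) + 0.6 * 0.43"
    using quad_ge[of "m - 0.43"] assms by (simp add: prof_def poly_pcompose add.commute)
qed (use assms in auto)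

text \<open>
The end h = 1 - m of the range, where the larger slice is the whole cube. Both sides equal 1 at
m = 0, so a factor m is split off before the polynomial is tested.
\<close>

lemma chord_at_full_slice:
  assumes "0 \<le> m" "m \<le> 0.5"
  shows "2 * prof m \<le> quad (m - (1 - m)) + kap * prof (m + (1 - m)) + 1 * (1 - m)"
proof -
  have "0 \<le> poly ([:2 * 0.4142, - 4 * 0.4142:] - smult 2 ([:0.0858, -0.4928, 0.052, -0.145, 0, 0.18, -0.18:])) m"
    using assms by (rule poly_nonneg_on_interval) (simp add: pcompose_pCons)
  then have "0 \<le> m * poly ([:2 * 0.4142, - 4 * 0.4142:] - smult 2 ([:0.0858, -0.4928, 0.052, -0.145, 0, 0.18, -0.18:])) m"
    using assms by (intro mult_nonneg_nonneg)
  also have "\<dots> = 1 + 2 * 0.4142 * m * (1 - 2 * m) - 2 * prof m"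
    unfolding prof_expand by (simp add: field_simps power_numeral_reduce)
  finally have "2 * prof m \<le> 1 + 2 * 0.4142 * m * (1 - 2 * m)" by simp
  also have "\<dots> \<le> 1 + 2 * kap * m * (1 - 2 * m)"
    using assms kap_bounds by (intro add_left_mono mult_right_mono) auto
  also have "\<dots> = quad (m - (1 - m)) + kap * prof (m + (1 - m)) + 1 * (1 - m)"
    by (simp add: quad_def prof_def prof_poly_def field_simps)
  finally show ?thesis .
qed

lemma far_mixed_chord_left:
  assumes "0 \<le> m" "m \<le> 0.35" "0.43 \<le> h" "h \<le> 1 - m"
  shows "2 * prof m \<le> quad (m - h) + kap * prof (m + h) + 1 * h"
proof (rule concave_two_point_between[OF quad_concave prof_concave])
  have "0 \<le> poly (quad_poly 0.4142 \<circ>\<^sub>p [:-0.43, 1:] + smult 0.4142 (prof_poly \<circ>\<^sub>p [:0.43, 1:]) + [:0.43:] - smult 2 prof_poly) m"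
    by (rule poly_nonneg_on_interval[OF assms(1,2)])
       (simp add: prof_poly_def quad_poly_def pcompose_pCons)
  moreover have "0.4142 * prof (m + 0.43) \<le> kap * prof (m + 0.43)"
    using assms kap_bounds prof_nonneg[of "m + 0.43"] by (intro mult_right_mono) auto
  ultimately show "2 * prof m \<le> quad (m - 0.43) + kap * prof (m + 0.43) + 1 * 0.43"
    using quad_ge[of "m - 0.43"] assms by (auto simp: prof_def poly_pcompose add.commute)
qed (use assms kap_bounds chord_at_full_slice[of m] in auto)

text \<open>
The end h = m of the range, where the smaller slice is a half-cube.
\<close>

lemma chord_at_centre:
  assumes "0.35 \<le> m" "m \<le> 0.5"
  shows "2 * prof m \<le> 1/2 + kap * prof (m + m) + 1 * m"
proof -
  have "0 \<le> poly ([:0.5, 1:] + smult 0.4142 (prof_poly \<circ>\<^sub>p [:0, 2:]) - smult 2 prof_poly) m"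
    by (rule poly_nonneg_on_interval[OF assms])
       (simp add: prof_poly_def pcompose_pCons)
  moreover have "0.4142 * prof (m + m) \<le> kap * prof (m + m)"
    using assms kap_bounds prof_nonneg[of "m + m"] by (intro mult_right_mono) auto
  ultimately show ?thesis
    by (simp add: prof_def poly_pcompose mult_2_right)
qed

lemma far_mixed_chord_right:
  assumes "0.35 \<le> m" "m \<le> 0.5" "m \<le> h" "h \<le> 1 - m"
  shows "2 * prof m \<le> quad (m - h) + kap * prof (m + h) + 1 * h"
proof (rule concave_two_point_between[OF quad_concave prof_concave])
  show "2 * prof m \<le> quad (m - m) + kap * prof (m + m) + 1 * m"
    using chord_at_centre[OF assms(1,2)] by (simp add: quad_def)
qed (use assms kap_bounds chord_at_full_slice[of m] in auto)

lemma far_upper_chord: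
  assumes "0.35 \<le> h" "h \<le> m" "h \<le> 1 - m"
  shows "2 * prof m \<le> prof (m - h) + kap * prof (m + h) + 1 * h"
proof (rule concave_two_point_between[OF prof_concave prof_concave])
  have m: "0.35 \<le> m" "m \<le> 0.65" using assms by auto
  have "0 \<le> poly (prof_poly \<circ>\<^sub>p [:-0.35, 1:] + smult 0.4142 (prof_poly \<circ>\<^sub>p [:0.35, 1:]) + [:0.35:] - smult 2 prof_poly) m"
    by (rule poly_nonneg_on_interval[OF m]) (simp add: prof_poly_def pcompose_pCons)
  moreover have "0.4142 * prof (m + 0.35) \<le> kap * prof (m + 0.35)"
    using m kap_bounds prof_nonneg[of "m + 0.35"] by (intro mult_right_mono) auto
  ultimately show "2 * prof m \<le> prof (m - 0.35) + kap * prof (m + 0.35) + 1 * 0.35"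
    by (auto simp: prof_def poly_pcompose add.commute)
  show "2 * prof m \<le> prof (m - min m (1 - m)) + kap * prof (m + min m (1 - m)) + 1 * min m (1 - m)"
  proof (cases "m \<le> 1/2")
    case True
    then show ?thesis using chord_at_centre[of m] m by (simp add: prof_def prof_poly_def)
  next
    case False
    then have m': "0.5 \<le> m" by simp
    have "0 \<le> poly (prof_poly \<circ>\<^sub>p [:-1, 2:] + [:1, -1:] - smult 2 prof_poly) m"
      by (rule poly_nonneg_on_interval[OF m' m(2)]) (simp add: prof_poly_def pcompose_pCons)
    moreover have "prof 1 = 0" by (simp add: prof_def prof_poly_def)
    ultimately show ?thesis using False
      by (simp add: prof_def poly_pcompose min_def algebra_simps)
  qed
qed (use assms kap_bounds in auto)

section \<open>Midpoint above one half, close points\<close>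

text \<open>
The coefficients even0, even2, even4 of the even powers of h in the second difference of prof,
divided by h^2.
\<close>

definition even0 :: "real poly" where "even0 = [:-0.9856, 0.312, -1.74, 0, 5.4, -7.56:]"
definition even2 :: "real poly" where "even2 = [:-0.29, 0, 5.4, -12.6:]"
definition even4 :: "real poly" where "even4 = [:0.36, -2.52:]"

lemma prof_second_difference:
  "prof (m + h) + prof (m - h) - 2 * prof m
     = h^2 * (poly even0 m + poly even2 m * h^2 + poly even4 m * h^4)"
proof -
  have "2 * prof (m + h) + 2 * prof (m - h) - 2 * (2 * prof m)
     = 2 * (h^2 * (poly even0 m + poly even2 m * h^2 + poly even4 m * h^4))"
    unfolding prof_expand by (simp add: even0_def even2_def even4_def field_simps power_numeral_reduce)
  then show ?thesis by simp
qed

text \<open>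
The coefficients of h^3 and h^5 in 2 * prof m + prof (m + h) - prof (m - h).
\<close>

definition odd3 :: "real poly" where "odd3 = [:0.104, -1.16, 0, 7.2, -12.6:]"
definition odd5 :: "real poly" where "odd5 = [:0, 2.16, -7.56:]"

lemma prof_odd_difference:
  "2 * prof m + prof (m + h) - prof (m - h)
     = poly (smult 2 prof_poly) m + h * poly (pderiv (smult 2 prof_poly)) m + h^3 * (poly odd3 m + h^2 * poly odd5 m - 0.36 * h^4)"
proof -
  have "2 * (2 * prof m) + 2 * prof (m + h) - 2 * prof (m - h)
     = 2 * (poly (smult 2 prof_poly) m + h * poly (pderiv (smult 2 prof_poly)) m + h^3 * (poly odd3 m + h^2 * poly odd5 m - 0.36 * h^4))"
    unfolding prof_expand by (simp add: prof_poly_def pderiv_pCons odd3_def odd5_def field_simps power_numeral_reduce)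
  then show ?thesis by simp
qed

text \<open>
The tangent criterion divided by h^2. It compares the second difference of prof with a multiple
of 2 * prof m plus an odd function of h.
\<close>

lemma prof_two_point_criterion:
  assumes "0 \<le> poly even0 m + poly even2 m * h^2 + poly even4 m * h^4 + 2 * q
     - q^2 * (poly (smult 2 prof_poly) m + h * poly (pderiv (smult 2 prof_poly)) m + h^3 * (poly odd3 m + h^2 * poly odd5 m - 0.36 * h^4))"
  shows "2 * prof m \<le> prof (m - h) + lift (prof (m + h)) h"
proof (rule two_point_from_tangent)
  let ?a = "prof (m - h)" and ?b = "prof (m + h)" and ?c = "prof m"
  let ?S = "poly even0 m + poly even2 m * h^2 + poly even4 m * h^4"
  let ?W = "poly (smult 2 prof_poly) m + h * poly (pderiv (smult 2 prof_poly)) m + h^3 * (poly odd3 m + h^2 * poly odd5 m - 0.36 * h^4)"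
  have "(1 + (q*h)^2) * (?a - 2 * ?c) + (1 - (q*h)^2) * ?b + 2 * q * h^2
      = (?b + ?a - 2 * ?c) + h^2 * (2 * q - q^2 * (2 * ?c + ?b - ?a))"
    by (simp add: power_mult_distrib algebra_simps)
  also have "\<dots> = h^2 * (?S + 2 * q - q^2 * ?W)"
    unfolding prof_second_difference prof_odd_difference by (simp add: algebra_simps)
  also have "\<dots> \<ge> 0" using assms by simp
  finally show "0 \<le> (1 + (q*h)^2) * (?a - 2 * ?c) + (1 - (q*h)^2) * ?b + 2 * q * h^2" .
qed

text \<open>
The signs make the polynomial concave on [0, H], so it lies above its chord.
\<close>

lemma quartic_nonneg_between:
  fixes h H :: real
  assumes h: "0 \<le> h" "h \<le> H" and coeffs: "0 \<le> c2" "0 \<le> c3" "0 \<le> c4"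
    and ends: "0 \<le> c0" "0 \<le> c0 - c1 * H - c2 * H^2 - c3 * H^3 - c4 * H^4"
  shows "0 \<le> c0 - c1 * h - c2 * h^2 - c3 * h^3 - c4 * h^4"
proof (cases "H = 0")
  case True
  then show ?thesis using h ends by simp
next
  case False
  then have H: "0 < H" using h by simp
  have pow: "h ^ Suc k * H \<le> H ^ Suc k * h" for k
  proof -
    have "h ^ k * (h * H) \<le> H ^ k * (h * H)"
      using h by (intro mult_right_mono power_mono) auto
    then show ?thesis by (simp add: mult_ac)
  qed
  have "0 \<le> c0 * (H - h) + (c0 - c1 * H - c2 * H^2 - c3 * H^3 - c4 * H^4) * h"
    using h ends by simp
  also have "\<dots> = (c0 - c1 * h) * H - c2 * (H^2 * h) - c3 * (H^3 * h) - c4 * (H^4 * h)"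
    by (simp add: algebra_simps)
  also have "\<dots> \<le> (c0 - c1 * h) * H - c2 * (h^2 * H) - c3 * (h^3 * H) - c4 * (h^4 * H)"
    using mult_left_mono[OF pow[of 1] coeffs(1)] mult_left_mono[OF pow[of 2] coeffs(2)]
      mult_left_mono[OF pow[of 3] coeffs(3)]
    by (simp add: numeral_eq_Suc)
  also have "\<dots> = (c0 - c1 * h - c2 * h^2 - c3 * h^3 - c4 * h^4) * H"
    by (simp add: algebra_simps)
  finally show ?thesis using H by (simp add: zero_le_mult_iff)
qed

text \<open>
The criterion with h replaced by a polynomial H in m, after omission of the terms of order h^3
on the right; these have a favourable sign for m \<ge> 1/7.
\<close>

definition endpoint_poly :: "real \<Rightarrow> real poly \<Rightarrow> real poly" where
  "endpoint_poly q H = even0 + even2 * H^2 + even4 * H^4 + [:2 * q:]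
     - smult (q^2) (smult 2 prof_poly + H * pderiv (smult 2 prof_poly))"

lemma near_upper_step:
  assumes m: "1/7 \<le> m" "m \<le> 1" and h: "0 \<le> h" "h \<le> 0.35" "h \<le> poly H m"
    and ends: "0 \<le> poly (endpoint_poly q 0) m" "0 \<le> poly (endpoint_poly q H) m"
  shows "2 * prof m \<le> prof (m - h) + lift (prof (m + h)) h"
proof (rule prof_two_point_criterion)
  have even2: "0 \<le> poly (- even2) m"
    using m by (intro poly_nonneg_on_interval[where a = "1/7" and b = 1]) (simp_all add: even2_def pcompose_pCons)
  have even4: "0 \<le> poly (- even4) m"
    using m by (simp add: even4_def)
  have "0 \<le> poly (- odd3) m"
    using m by (intro poly_nonneg_on_interval[where a = "1/7" and b = 1]) (simp_all add: odd3_def pcompose_pCons)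
  moreover have "0 \<le> poly (- odd3 - smult (0.35^2) odd5) m"
    using m by (intro poly_nonneg_on_interval[where a = "1/7" and b = 1]) (simp_all add: odd3_def odd5_def pcompose_pCons power2_eq_square)
  moreover have "h^2 * poly odd5 m \<le> max 0 (0.35^2 * poly odd5 m)"
  proof (cases "0 \<le> poly odd5 m")
    case True
    then have "h^2 * poly odd5 m \<le> 0.35^2 * poly odd5 m"
      using h by (intro mult_right_mono power_mono) auto
    then show ?thesis by simp
  next
    case False
    then show ?thesis by (simp add: mult_nonneg_nonpos)
  qed
  ultimately have "poly odd3 m + h^2 * poly odd5 m \<le> 0"
    by (auto simp: max_def split: if_splits)
  moreover have "0 \<le> 0.36 * h^4" by simp
  ultimately have "poly odd3 m + h^2 * poly odd5 m - 0.36 * h^4 \<le> 0" by linarith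
  then have odd: "h^3 * (poly odd3 m + h^2 * poly odd5 m - 0.36 * h^4) \<le> 0"
    using h by (intro mult_nonneg_nonpos) auto
  let ?p = "poly (smult 2 prof_poly) m" and ?d = "poly (pderiv (smult 2 prof_poly)) m"
  have "0 \<le> (poly even0 m + 2 * q - q^2 * ?p) - (q^2 * ?d) * h - poly (- even2) m * h^2 - 0 * h^3 - poly (- even4) m * h^4"
    by (rule quartic_nonneg_between[OF h(1) h(3) even2 order_refl even4])
       (use ends in \<open>simp_all add: endpoint_poly_def algebra_simps\<close>)
  moreover have "q^2 * (h^3 * (poly odd3 m + h^2 * poly odd5 m - 0.36 * h^4)) \<le> 0"
    by (rule mult_nonneg_nonpos[OF zero_le_power2 odd])
  ultimately show "0 \<le> poly even0 m + poly even2 m * h^2 + poly even4 m * h^4 + 2 * q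
     - q^2 * (?p + h * ?d + h^3 * (poly odd3 m + h^2 * poly odd5 m - 0.36 * h^4))"
    by (simp add: algebra_simps)
qed

text \<open>
The parameter q follows 1 / (2 * prof m), which grows from about 1 to infinity as m runs to 1; a
relative error of about one tenth is allowed, hence the five values. The range of h is bounded
by 0.35 and, close to the full cube, by 1 - m.
\<close>

lemma near_upper:
  assumes m: "1/7 \<le> m" "m \<le> 1" and h: "0 \<le> h" "h \<le> 0.35" "h \<le> 1 - m"
  shows "2 * prof m \<le> prof (m - h) + lift (prof (m + h)) h"
proof -
  have step: ?thesis
    if "lo \<le> m" "m \<le> hi" "h \<le> poly H m"
      "bisection_nonneg 4 (endpoint_poly q 0 \<circ>\<^sub>p [:lo, hi - lo:])"
      "bisection_nonneg 4 (endpoint_poly q H \<circ>\<^sub>p [:lo, hi - lo:])" for lo hi q H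
    by (rule near_upper_step[OF m h(1,2) that(3)]) (rule poly_nonneg_on_interval[OF that(1,2)], fact)+
  note defs = endpoint_poly_def even0_def even2_def even4_def prof_poly_def pderiv_pCons pcompose_pCons power_numeral_reduce
  consider "m \<le> 0.46" | "0.46 \<le> m" "m \<le> 0.63" | "0.63 \<le> m" "m \<le> 0.65" | "0.65 \<le> m" "m \<le> 0.73"
    | "0.73 \<le> m" "m \<le> 0.81" | "0.81 \<le> m" by linarith
  then show ?thesis
  proof cases
    case 1
    show ?thesis by (rule step[of "1/7" "0.46" "[:0.35:]" 1]) (use m h 1 in \<open>simp_all add: defs\<close>)
  next
    case 2
    show ?thesis by (rule step[of "0.46" "0.63" "[:0.35:]" "1.25"]) (use h 2 in \<open>simp_all add: defs\<close>)
  next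
    case 3
    show ?thesis by (rule step[of "0.63" "0.65" "[:0.35:]" "1.6"]) (use h 3 in \<open>simp_all add: defs\<close>)
  next
    case 4
    show ?thesis by (rule step[of "0.65" "0.73" "[:1, -1:]" "1.6"]) (use h 4 in \<open>simp_all add: defs\<close>)
  next
    case 5
    show ?thesis by (rule step[of "0.73" "0.81" "[:1, -1:]" "1.9"]) (use h 5 in \<open>simp_all add: defs\<close>)
  next
    case 6
    show ?thesis by (rule step[of "0.81" 1 "[:1, -1:]" "2.4"]) (use m h 6 in \<open>simp_all add: defs\<close>)
  qed
qed

text \<open>
Near the centre prof increases, so the first-order term of the criterion has the wrong sign.
Since h \<le> m, it is of the order of m and is outweighed by the constant term and the terms of
second order.
\<close>

lemma near_upper_left:
  assumes m: "0 \<le> m" "m \<le> 1/7" and h: "0 \<le> h" "h \<le> m"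
  shows "2 * prof m \<le> prof (m - h) + lift (prof (m + h)) h"
proof (rule prof_two_point_criterion[where q = 1])
  let ?p = "poly (smult 2 prof_poly) m" and ?d = "poly (pderiv (smult 2 prof_poly)) m"
  have even2: "0 \<le> poly (- even2) m"
    using m by (intro poly_nonneg_on_interval[where a = 0 and b = "1/7"]) (simp_all add: even2_def pcompose_pCons)
  have even4: "0 \<le> poly even4 m * h^4"
    using m by (simp add: even4_def)
  have "0 \<le> poly odd5 m"
    using m by (intro poly_nonneg_on_interval[where a = 0 and b = "1/7"]) (simp_all add: odd5_def pcompose_pCons)
  then have "h^2 * poly odd5 m \<le> (1/7)^2 * poly odd5 m"
    using m h by (intro mult_right_mono power_mono) auto
  moreover
  have "0 \<le> poly ([:0.12:] - odd3 - smult ((1/7)^2) odd5) m"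
    using m by (intro poly_nonneg_on_interval[where a = 0 and b = "1/7"]) (simp_all add: odd3_def odd5_def pcompose_pCons power2_eq_square)
  then have "poly odd3 m + (1/7)^2 * poly odd5 m \<le> 0.12" by simp
  moreover have "0 \<le> 0.36 * h^4" by simp
  ultimately have "poly odd3 m + h^2 * poly odd5 m - 0.36 * h^4 \<le> 0.12" by linarith
  then have odd: "h^3 * (poly odd3 m + h^2 * poly odd5 m - 0.36 * h^4) \<le> h^3 * 0.12"
    using h by (intro mult_left_mono) auto
  have "0 \<le> poly (even0 + [:2:] - smult 2 prof_poly) m"
    using m by (intro poly_nonneg_on_interval[where a = 0 and b = "1/7"]) (simp_all add: even0_def prof_poly_def pcompose_pCons)
  moreover have "0 \<le> poly (even0 + even2 * [:0, 1:]^2 + [:2:] - smult 2 prof_poly - [:0, 1:] * pderiv (smult 2 prof_poly) - smult 0.12 ([:0, 1:]^3)) m"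
    using m by (intro poly_nonneg_on_interval[where a = 0 and b = "1/7"])
      (simp_all add: even0_def even2_def prof_poly_def pderiv_pCons pcompose_pCons power_numeral_reduce)
  ultimately have "0 \<le> (poly even0 m + 2 - ?p) - ?d * h - poly (- even2) m * h^2 - 0.12 * h^3 - 0 * h^4"
    by (intro quartic_nonneg_between[OF h even2 _ order_refl]) (simp_all add: algebra_simps)
  with odd even4 show "0 \<le> poly even0 m + poly even2 m * h^2 + poly even4 m * h^4 + 2 * 1
     - 1^2 * (?p + h * ?d + h^3 * (poly odd3 m + h^2 * poly odd5 m - 0.36 * h^4))"
    by (simp add: algebra_simps)
qed

lemma quadratic_nonneg_between:
  fixes h H :: real
  assumes "0 \<le> h" "h \<le> H" "0 < H" "0 \<le> c0" "0 \<le> c0 + c1 * (H / 2)" "0 \<le> c0 + c1 * H + c2 * H^2"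
  shows "0 \<le> c0 + c1 * h + c2 * h^2"
proof -
  have "0 \<le> c0 * (H - h)^2 + 2 * (c0 + c1 * (H / 2)) * h * (H - h) + (c0 + c1 * H + c2 * H^2) * h^2"
    by (intro add_nonneg_nonneg mult_nonneg_nonneg[OF mult_nonneg_nonneg] mult_nonneg_nonneg[OF assms(4)]
          mult_nonneg_nonneg[OF assms(6)] mult_nonneg_nonneg[OF _ assms(5)])
       (use assms in simp_all)
  also have "\<dots> = (c0 + c1 * h + c2 * h^2) * H^2"
    by (simp add: power2_eq_square field_simps)
  finally show ?thesis using assms by (simp add: zero_le_mult_iff)
qed

lemma quad_lower:
  assumes "-1 \<le> x" "x \<le> 0"
  shows "1 + (1 - 0.8284) * x - 0.8284 * x^2 \<le> 2 * quad x"
  using quad_ge[OF assms] by (simp add: poly_quad_poly power2_eq_square field_simps)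

lemma prof_lower:
  assumes "0 \<le> y" "y \<le> 1"
  shows "1 + 0.1716 * y - 0.9856 * y^2 + 0.104 * y^3 - 0.29 * y^4 \<le> 2 * prof y"
proof -
  have "y^7 \<le> y^6" using assms by (intro power_decreasing) auto
  then show ?thesis unfolding prof_expand by simp
qed

text \<open>
For m \<le> 0.35 the term of degree 6 is absorbed into the quartic term, as 0.36 * 0.35^2 =
0.0441.
\<close>

lemma prof_upper:
  assumes "0 \<le> m" "m \<le> 0.35"
  shows "2 * prof m \<le> 1 + 0.1716 * m - 0.9856 * m^2 + 0.104 * m^3 - 0.2459 * m^4"
proof -
  have "m^4 * m^2 \<le> m^4 * 0.35^2"
    using assms by (intro mult_left_mono power_mono) auto
  then have "m^6 \<le> m^4 * (49/400)" by (simp add: power_numeral_reduce)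
  moreover have "0 \<le> m^7" using assms by simp
  ultimately have "m^6 - m^7 \<le> m^4 * (49/400)" by linarith
  then show ?thesis unfolding prof_expand by simp
qed

text \<open>
Close to the point (1/2, 1/2) everything is of second order, so m = r * h is substituted and h^2
is divided out. What is left is a polynomial in h \<in> [0, 0.35] whose coefficients are
polynomials in r \<in> [0, 1]; its cubic term is bounded by a quadratic one and its quartic term
is nonnegative. It is essential to use the quadratic piece for the smaller slice: its second
derivative exceeds that of prof at the centre.
\<close>

lemma near_mixed:
  assumes m: "0 \<le> m" and h: "m \<le> h" "h \<le> 0.35"
  shows "2 * prof m \<le> quad (m - h) + lift (prof (m + h)) h"
proof (cases "h = 0")
  case True
  with m h have "m = 0" by simp
  with True show ?thesis
    using lift_ge_norm[of "prof 0" 0] by (simp add: prof_def prof_poly_def quad_def)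
next
  case False
  then have h0: "0 < h" using m h by simp
  define r where "r = m / h"
  have r: "0 \<le> r" "r \<le> 1" and mr: "m = r * h"
    using m h h0 by (auto simp: r_def)
  define a where "a = 1 + (1 - 0.8284) * (m - h) - 0.8284 * (m - h)^2"
  define b where "b = 1 + 0.1716 * (m + h) - 0.9856 * (m + h)^2 + 0.104 * (m + h)^3 - 0.29 * (m + h)^4"
  define c where "c = 1 + 0.1716 * m - 0.9856 * m^2 + 0.104 * m^3 - 0.2459 * m^4"
  have a: "a \<le> 2 * quad (m - h)"
    unfolding a_def by (rule quad_lower) (use m h in auto)
  have b: "b \<le> 2 * prof (m + h)"
    unfolding b_def by (rule prof_lower) (use m h in auto)
  have c: "2 * prof m \<le> c"
    unfolding c_def by (rule prof_upper) (use m h in auto)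
  \<comment> \<open>These are the coefficients of 1, h and h^2. In c2 the constant coefficient -0.1328 has been
    lowered by 1.04 * 0.35, which pays for the cubic term.\<close>
  define c0 c1 c2 :: "real poly" where "c0 = [:0.186, -0.3144, 0.1572:]"
    and "c1 = [:-0.2392, -0.0312, 0.312, -0.104:]" and "c2 = [:-0.4968, 2.468, 0.3884, -1.16, 0.2018:]"
  have "0 \<le> poly c0 r" "0 \<le> poly (c0 + smult (0.35 / 2) c1) r" "0 \<le> poly (c0 + smult 0.35 c1 + smult (0.35^2) c2) r"
    by (rule poly_nonneg_on_interval[OF r], simp add: c0_def c1_def c2_def pcompose_pCons power2_eq_square)+
  then have "0 \<le> poly c0 r" "0 \<le> poly c0 r + poly c1 r * (0.35 / 2)"
      "0 \<le> poly c0 r + poly c1 r * 0.35 + poly c2 r * 0.35^2"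
    by (simp_all add: field_simps)
  from quadratic_nonneg_between[OF _ h(2) _ this]
  have "0 \<le> poly c0 r + poly c1 r * h + poly c2 r * h^2"
    using h0 by simp
  moreover have "0 \<le> h^2 * ((1.04 * (0.35 - h)) + h * (0.312 * (1 - r) + 0.312 * (1 - r^2) + 0.312 * (1 - r^3)))"
    using h h0 r by (intro mult_nonneg_nonneg add_nonneg_nonneg) (auto simp: power_le_one)
  moreover have "0 \<le> h^4 * (0.29 + 1.16 * r + 1.74 * r^2 + 1.16 * r^3 + 0.7818 * r^4)"
    using r by simp
  ultimately have "0 \<le> h^2 * (poly c0 r + poly c1 r * h + poly c2 r * h^2
      + h^2 * ((1.04 * (0.35 - h)) + h * (0.312 * (1 - r) + 0.312 * (1 - r^2) + 0.312 * (1 - r^3)))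
      + h^4 * (0.29 + 1.16 * r + 1.74 * r^2 + 1.16 * r^3 + 0.7818 * r^4))"
    by simp
  also have "\<dots> = (1 + h^2) * (a - 2 * c) + (1 - h^2) * b + 4 * h^2"
    unfolding a_def b_def c_def c0_def c1_def c2_def mr by (simp add: field_simps power_numeral_reduce)
  also have "\<dots> \<le> (1 + h^2) * (2 * quad (m - h) - 2 * (2 * prof m)) + (1 - h^2) * (2 * prof (m + h)) + 4 * h^2"
  proof -
    have "h^2 \<le> 1" using h h0 by (simp add: power_le_one)
    then show ?thesis using a b c by (intro add_mono mult_left_mono) auto
  qed
  finally show ?thesis
    by (intro two_point_from_tangent[where q = 1]) (simp add: algebra_simps)
qed

section \<open>Midpoint below one half\<close>

definition prof_trunc :: "real poly" where
  "prof_trunc = smult (1/2) [:1, 0.1716, -0.9856, 0.104, -0.29:]"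

lemma prof_trunc_le: "0 \<le> y \<Longrightarrow> y \<le> 1 \<Longrightarrow> poly prof_trunc y \<le> prof y"
  using prof_lower[of y] by (simp add: prof_trunc_def power_numeral_reduce field_simps)

text \<open>
By the identity for second differences the claim is (quad w + 2 * kap * v)^2 - v \<le> (prof
w)^2 with v = h^2. The left side is convex in v, so the two ends v = w^2, where the midpoint is
1/2, and v = 0.47^2 suffice.
\<close>

lemma low_midpoint_norm:
  assumes w: "0 \<le> w" "w \<le> h" and h: "h \<le> 0.47"
  shows "2 * quad (w - h) \<le> quad (w - 2 * h) + lift (prof w) h"
proof -
  have w': "0 \<le> w" "w \<le> 0.47" using w h by auto
  have l: "0 \<le> poly prof_trunc w" "(poly prof_trunc w)^2 \<le> (prof w)^2"
  proof -
    show "0 \<le> poly prof_trunc w"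
      using w' by (rule poly_nonneg_on_interval) (simp add: prof_trunc_def pcompose_pCons)
    then show "(poly prof_trunc w)^2 \<le> (prof w)^2"
      using prof_trunc_le[of w] w' by (intro power_mono) auto
  qed
  have q: "0 \<le> quad w"
  proof -
    have "2 * kap * w \<le> 2 * 0.5 * 1" using w' kap_bounds by (intro mult_mono) auto
    then show ?thesis using w' by (simp add: quad_def)
  qed
  have "(quad w + 2 * kap * w^2)^2 - w^2 \<le> (prof w)^2"
  proof -
    define u :: "real poly" where "u = smult (1/2) [:1, 1:] - smult 0.4142 [:0, 1, -1:]"
    have "0.4142 * (w * (1 - w)) \<le> kap * (w * (1 - w))"
      using w' kap_bounds by (intro mult_right_mono) auto
    then have "quad w + 2 * kap * w^2 \<le> poly u w"
      by (simp add: u_def quad_def power2_eq_square field_simps)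
    then have "(quad w + 2 * kap * w^2)^2 \<le> (poly u w)^2"
      using q kap_bounds by (intro power_mono) auto
    moreover have "0 \<le> poly (prof_trunc^2 + [:0, 0, 1:] - u^2) w"
      using w' by (rule poly_nonneg_on_interval) (simp add: u_def prof_trunc_def pcompose_pCons power2_eq_square)
    then have "(poly u w)^2 \<le> (poly prof_trunc w)^2 + w^2"
      by (simp add: power2_eq_square)
    ultimately show ?thesis using l by linarith
  qed
  moreover have "(quad w + 2 * kap * 0.47^2)^2 - 0.47^2 \<le> (prof w)^2"
  proof -
    define u :: "real poly" where "u = smult (1/2) [:1, 1:] - smult 0.4142 [:0, 1, 1:] + [:2 * 0.41422 * 0.47^2:]"
    have "0.4142 * (w * (1 + w)) \<le> kap * (w * (1 + w))"
      using w' kap_bounds by (intro mult_right_mono) auto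
    then have "quad w + 2 * kap * 0.47^2 \<le> poly u w"
      using kap_bounds by (simp add: u_def quad_def power2_eq_square field_simps)
    then have "(quad w + 2 * kap * 0.47^2)^2 \<le> (poly u w)^2"
      using q kap_bounds by (intro power_mono) auto
    moreover have "0 \<le> poly (prof_trunc^2 + [:0.47^2:] - u^2) w"
      using w' by (rule poly_nonneg_on_interval) (simp add: u_def prof_trunc_def pcompose_pCons power2_eq_square)
    then have "(poly u w)^2 \<le> (poly prof_trunc w)^2 + 0.47^2"
      by (simp add: power2_eq_square)
    ultimately show ?thesis using l by linarith
  qed
  moreover have "w^2 \<le> h^2" "h^2 \<le> 0.47^2"
    using w h by (auto intro!: power_mono)
  ultimately have "(quad w + 2 * kap * h^2)^2 - h^2 \<le> (prof w)^2"
    using square_minus_between[of "w^2" "h^2" "0.47^2" "quad w" "2 * kap" "(prof w)^2"] by simp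
  then have "quad w + 2 * kap * h^2 \<le> sqrt ((prof w)^2 + h^2)"
    by (intro real_le_rsqrt) simp
  then show ?thesis
    using quad_identity[of "w - h" h] lift_ge_norm[of "prof w" h] by simp
qed

text \<open>
The case of an empty smaller slice: with the chord bound for lift it is exactly this inequality,
as 2 * y * (1 - y) is (1 - w^2) / 2.
\<close>

lemma prof_ge_parabola:
  assumes "0 \<le> w" "w \<le> 1"
  shows "(1 - w^2) / 2 \<le> prof w"
proof -
  have "0 \<le> (1 - w) * w * (0.1716 + 0.186 * w + 0.29 * w^2 + 0.36 * w^5)"
    using assms by (intro mult_nonneg_nonneg add_nonneg_nonneg) auto
  also have "\<dots> = 2 * prof w - (1 - w^2)"
    unfolding prof_expand by (simp add: field_simps power_numeral_reduce)
  finally show ?thesis by simp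
qed

text \<open>
For x \<le> 1/16 the entropy profile is at least 2 * x, and the chord bound reduces to the case
x = 0.
\<close>

lemma low_midpoint_small_slice:
  assumes "0 \<le> x" "x \<le> 1/16" and w: "0 \<le> w" "w \<le> 1" and x: "2 * x = 1 + w - 2 * h"
  shows "2 * quad (w - h) \<le> ent x + lift (prof w) h"
proof -
  have "2 * x \<le> ent x"
  proof (cases "x = 0")
    case False
    have "log 2 16 \<le> log 2 (1 / x)"
      using assms False by (subst log_le_cancel_iff) (auto simp: field_simps)
    moreover have "log 2 (16::real) = 4" using log_nat_power[of 2 2 4] by simp
    ultimately have "2 \<le> sqrt (log 2 (1 / x))" by (intro real_le_rsqrt) simp
    then show ?thesis
      unfolding ent_def mult.commute[of 2] using assms(1) by (rule mult_left_mono)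
  qed simp
  moreover have "kap * ((1 - w^2) / 2) \<le> kap * prof w"
    using prof_ge_parabola[OF w] kap_bounds by (intro mult_left_mono) auto
  moreover have "2 * quad (w - h) = 2 * x + kap * ((1 - w^2) / 2) + h - 2 * kap * (x * (w + x))"
  proof -
    have h: "h = (1 + w) / 2 - x" using x by (simp add: field_simps)
    show ?thesis unfolding quad_def h by (simp add: power2_eq_square field_simps)
  qed
  moreover have "0 \<le> kap * (x * (w + x))"
    using assms kap_bounds by simp
  ultimately show ?thesis using lift_ge_chord[of "prof w" h] by linarith
qed

text \<open>
A quadratic minorant of the entropy profile on [1/16, 0.265], accurate to about 0.001 near 0.18.
\<close>

definition ent_minorant :: "real poly" where
  "ent_minorant = [:0.282:] + smult 1.11 [:-0.18, 1:] - smult 2.5 ([:-0.18, 1:]^2)"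

lemma log2_inverse_eq: "0 < x \<Longrightarrow> log 2 (1 / x) = 2 - log 2 (4 * x)"
proof -
  assume "0 < x"
  then have "log 2 (4 * x) = log 2 4 + log 2 x" by (intro log_mult_pos) auto
  moreover have "log 2 (4::real) = 2" using log_nat_power[of 2 2 2] by simp
  ultimately show ?thesis using \<open>0 < x\<close> by (simp add: log_divide)
qed

text \<open>
The bound of ln (1 / (4 * x)) by a rational function together with 1 / ln 2 \<ge> 1.44.
\<close>

lemma log2_inverse_ge_left:
  assumes "0 < x" "x \<le> 1/4"
  shows "4.88 - 3.52 * x \<le> log 2 (1 / x) * (1 + 4 * x)"
proof -
  define g where "g = 2 * (1 - 4 * x) / (1 + 4 * x)"
  have g: "0 \<le> g" "g * (1 + 4 * x) = 2 * (1 - 4 * x)" using assms by (simp_all add: g_def)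
  have "g = 2 * (1 / (4 * x) - 1) / (1 / (4 * x) + 1)"
    using assms by (simp add: g_def divide_simps)
  also have "\<dots> \<le> ln (1 / (4 * x))"
    using assms by (intro ln_ge_pade) (auto simp: field_simps)
  also have "\<dots> = - ln (4 * x)" using assms by (simp add: ln_div)
  finally have "1.44 * g * (25/36) \<le> - ln (4 * x)" by simp
  moreover have "1.44 * g * ln 2 \<le> 1.44 * g * (25/36)"
    using g ln2_le_25_over_36 by (intro mult_left_mono) auto
  ultimately have "1.44 * g * ln 2 \<le> - ln (4 * x)" by linarith
  then have "1.44 * g \<le> (- ln (4 * x)) / ln 2" by (subst pos_le_divide_eq) auto
  then have "1.44 * g \<le> - log 2 (4 * x)" by (simp add: log_def)
  then have "(2 + 1.44 * g) * (1 + 4 * x) \<le> log 2 (1 / x) * (1 + 4 * x)"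
    using assms by (intro mult_right_mono) (auto simp: log2_inverse_eq)
  moreover have "(2 + 1.44 * g) * (1 + 4 * x) = 2 * (1 + 4 * x) + 1.44 * (g * (1 + 4 * x))"
    by (simp add: algebra_simps)
  ultimately show ?thesis unfolding g by (simp add: field_simps)
qed

lemma log2_inverse_ge_right:
  assumes "1/4 \<le> x" "x \<le> 0.28"
  shows "5.2 - 4.8 * x \<le> log 2 (1 / x) * (1 + 4 * x)"
proof -
  define g where "g = (4 * x - 1) / (1 + 4 * x)"
  have g: "0 \<le> g" "g * (1 + 4 * x) = 4 * x - 1" using assms by (simp_all add: g_def)
  have "g * (1 + 4 * x) \<le> g * (3.2 * (2/3))" using assms g(1) by (intro mult_left_mono) auto
  then have "4 * x - 1 \<le> 3.2 * g * (2/3)" unfolding g by simp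
  moreover have "3.2 * g * (2/3) \<le> 3.2 * g * ln 2"
    using g ln2_ge_two_thirds by (intro mult_left_mono) auto
  moreover have "ln (4 * x) \<le> 4 * x - 1" using assms by (intro ln_le_minus_one) auto
  ultimately have "ln (4 * x) \<le> 3.2 * g * ln 2" by linarith
  then have "log 2 (4 * x) \<le> 3.2 * g"
    by (simp add: log_def pos_divide_le_eq)
  then have "(2 - 3.2 * g) * (1 + 4 * x) \<le> log 2 (1 / x) * (1 + 4 * x)"
    using assms by (intro mult_right_mono) (auto simp: log2_inverse_eq)
  moreover have "(2 - 3.2 * g) * (1 + 4 * x) = 2 * (1 + 4 * x) - 3.2 * (g * (1 + 4 * x))"
    by (simp add: algebra_simps)
  ultimately show ?thesis unfolding g by (simp add: field_simps)
qed

lemma ent_minorant_le: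
  assumes "1/16 \<le> x" "x \<le> 0.265"
  shows "poly ent_minorant x \<le> ent x"
proof -
  define c :: "real poly" where "c = (if x \<le> 1/4 then [:4.88, -3.52:] else [:5.2, -4.8:])"
  have "poly c x \<le> log 2 (1 / x) * (1 + 4 * x)"
    using assms log2_inverse_ge_left[of x] log2_inverse_ge_right[of x] by (auto simp: c_def mult.commute)
  then have "x^2 * poly c x \<le> x^2 * (log 2 (1 / x) * (1 + 4 * x))"
    by (rule mult_left_mono) simp
  moreover have "0 \<le> poly ([:0, 0, 1:] * c - ent_minorant^2 * [:1, 4:]) x"
  proof (cases "x \<le> 1/4")
    case True
    with assms(1) show ?thesis
      by (rule poly_nonneg_on_interval) (use True in \<open>simp add: c_def ent_minorant_def pcompose_pCons power2_eq_square\<close>)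
  next
    case False
    then have "1/4 \<le> x" by simp
    then show ?thesis using assms(2)
      by (rule poly_nonneg_on_interval) (use False in \<open>simp add: c_def ent_minorant_def pcompose_pCons power2_eq_square\<close>)
  qed
  moreover have "poly ([:0, 0, 1:] * c - ent_minorant^2 * [:1, 4:]) x = x^2 * poly c x - (poly ent_minorant x)^2 * (1 + 4 * x)"
  proof -
    have "poly [:0, 0, 1:] x = x^2" "poly [:1, 4:] x = 1 + 4 * x"
      by (simp_all add: power2_eq_square)
    then show ?thesis by (simp only: poly_diff poly_mult poly_power)
  qed
  ultimately have "(poly ent_minorant x)^2 * (1 + 4 * x) \<le> (x^2 * log 2 (1 / x)) * (1 + 4 * x)"
    unfolding mult.assoc by linarith
  then have "(poly ent_minorant x)^2 \<le> (ent x)^2"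
    using assms by (simp add: ent_sq)
  then show ?thesis by (rule power2_le_imp_le) (use ent_nonneg[of x] assms in simp)
qed

text \<open>
For larger h than 0.47 the norm bound may fail. At the end h = 1 - \<mu> the smaller slice is
empty; at the end h = 0.47 it has measure between 1/16 and 0.265.
\<close>

lemma low_midpoint_chord:
  assumes \<mu>: "0 \<le> \<mu>" "\<mu> \<le> 0.405" and h: "0.47 \<le> h" "h \<le> 1 - \<mu>"
  shows "2 * quad (- \<mu>) \<le> ent ((1 + (- \<mu> - h)) / 2) + kap * prof (- \<mu> + h) + 1 * h"
proof (rule concave_two_point_between[where f = "\<lambda>w. ent ((1 + w) / 2)" and I = "{-1..1}" and ?h0.0 = "0.47" and ?h1.0 = "1 - \<mu>"])
  show "concave_on {-1..1} (\<lambda>w. ent ((1 + w) / 2))"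
  proof (rule concave_on_linorderI)
    fix t x y :: real assume "0 < t" "t < 1" "x \<in> {-1..1}" "y \<in> {-1..1}"
    then have "(1 - t) * ent ((1 + x) / 2) + t * ent ((1 + y) / 2)
        \<le> ent ((1 - t) *\<^sub>R ((1 + x) / 2) + t *\<^sub>R ((1 + y) / 2))"
      by (intro concave_onD[OF ent_concave]) auto
    also have "(1 - t) *\<^sub>R ((1 + x) / 2) + t *\<^sub>R ((1 + y) / 2) = (1 + ((1 - t) *\<^sub>R x + t *\<^sub>R y)) / 2"
      by (simp add: field_simps)
    finally show "(1 - t) * ent ((1 + x) / 2) + t * ent ((1 + y) / 2) \<le> ent ((1 + ((1 - t) *\<^sub>R x + t *\<^sub>R y)) / 2)" .
  qed simp
  have "0 \<le> poly (ent_minorant \<circ>\<^sub>p [:0.265, -1/2:] + smult 0.4142 (prof_poly \<circ>\<^sub>p [:0.47, -1:]) + [:0.47:]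
      - smult 2 (quad_poly 0.41422 \<circ>\<^sub>p [:0, -1:])) \<mu>"
    by (rule poly_nonneg_on_interval[OF \<mu>])
       (simp add: ent_minorant_def prof_poly_def quad_poly_def pcompose_pCons power2_eq_square)
  moreover have "poly ent_minorant (0.265 - \<mu> / 2) \<le> ent (0.265 - \<mu> / 2)"
    using \<mu> by (intro ent_minorant_le) auto
  moreover have "0.4142 * prof (0.47 - \<mu>) \<le> kap * prof (0.47 - \<mu>)"
    using \<mu> kap_bounds by (intro mult_right_mono prof_nonneg) auto
  moreover have "quad (- \<mu>) \<le> poly (quad_poly 0.41422) (- \<mu>)"
    using \<mu> by (intro quad_le) auto
  ultimately have "2 * quad (- \<mu>) \<le> ent (0.265 - \<mu> / 2) + kap * prof (0.47 - \<mu>) + 1 * 0.47"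
    by (simp add: prof_def poly_pcompose)
  moreover have eqs: "0.265 - \<mu> / 2 = (1 + (- \<mu> - 0.47)) / 2" "0.47 - \<mu> = - \<mu> + 0.47"
    by (auto simp: field_simps)
  ultimately show "2 * quad (- \<mu>) \<le> ent ((1 + (- \<mu> - 0.47)) / 2) + kap * prof (- \<mu> + 0.47) + 1 * 0.47"
    unfolding eqs by blast
  have "kap * ((1 - (1 - 2 * \<mu>)^2) / 2) \<le> kap * prof (1 - 2 * \<mu>)"
    using \<mu> kap_bounds by (intro mult_left_mono prof_ge_parabola) auto
  moreover have "- \<mu> + (1 - \<mu>) = 1 - 2 * \<mu>" by simp
  ultimately show "2 * quad (- \<mu>) \<le> ent ((1 + (- \<mu> - (1 - \<mu>))) / 2) + kap * prof (- \<mu> + (1 - \<mu>)) + 1 * (1 - \<mu>)"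
    by (simp add: quad_def power2_eq_square field_simps)
qed (use assms kap_bounds prof_concave in auto)

section \<open>The two-point inequality\<close>

text \<open>
The Bellman function. At 1/4 and at 1/2 the adjacent pieces agree.
\<close>

definition bell :: "real \<Rightarrow> real" where
  "bell x = (if x \<le> 1/4 then ent x else if x \<le> 1/2 then quad (2 * x - 1) else prof (2 * x - 1))"

lemma bell_low: "x \<le> 1/4 \<Longrightarrow> bell x = ent x"
  by (simp add: bell_def)

lemma bell_mid:
  assumes "1/4 \<le> x" "x \<le> 1/2"
  shows "bell x = quad (2 * x - 1)"
proof (cases "x = 1/4")
  case True
  have "ent (1/4) = quad (2 * (1/4) - 1)"
    using ent_quad_compare[of "1/4"] by simp
  then show ?thesis unfolding True by (simp add: bell_low)
qed (use assms in \<open>simp add: bell_def\<close>)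

lemma bell_high:
  assumes "1/2 \<le> x"
  shows "bell x = prof (2 * x - 1)"
proof (cases "x = 1/2")
  case True
  show ?thesis unfolding True by (simp add: bell_def quad_def prof_def prof_poly_def)
qed (use assms in \<open>simp add: bell_def\<close>)

lemma bell_ge_ent: "0 \<le> x \<Longrightarrow> x \<le> 1/2 \<Longrightarrow> ent x \<le> bell x"
  using bell_low[of x] bell_mid[of x] ent_quad_compare(2)[of x] by (cases "x \<le> 1/4") auto

lemma bell_ge_quad: "0 \<le> x \<Longrightarrow> x \<le> 1/2 \<Longrightarrow> quad (2 * x - 1) \<le> bell x"
  using bell_low[of x] bell_mid[of x] ent_quad_compare(1)[of x] by (cases "x \<le> 1/4") auto

lemma bell_nonneg:
  assumes "0 \<le> x" "x \<le> 1"
  shows "0 \<le> bell x"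
proof (cases "x \<le> 1/2")
  case True
  then show ?thesis using assms bell_ge_ent[of x] ent_nonneg[of x] by simp
next
  case False
  then show ?thesis using assms bell_high[of x] prof_nonneg[of "2 * x - 1"] by simp
qed

lemma bell_0 [simp]: "bell 0 = 0" and bell_1 [simp]: "bell 1 = 0"
  by (simp_all add: bell_low bell_high prof_def prof_poly_def)

text \<open>
The cases are the positions of the three points relative to 1/4 and 1/2. In the ranges where the
smaller slice has measure at most 1/2, bell x is at least both the entropy profile and the
quadratic, so either may be used for x, whatever piece is in force.
\<close>

lemma bell_two_point:
  assumes "0 \<le> x" "x \<le> y" "y \<le> 1"
  shows "2 * bell ((x + y) / 2) \<le> bell x + lift (bell y) (y - x)"
proof -
  define m where "m = (x + y) / 2"
  define w where "w = 2 * y - 1"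
  define h where "h = y - x"
  have h: "0 \<le> h" and mw: "2 * m - 1 = w - h" and xw: "2 * x - 1 = w - 2 * h"
    using assms by (auto simp: m_def w_def h_def field_simps)
  have m: "0 \<le> m" "m \<le> 1" "x \<le> m" "m \<le> y" using assms by (auto simp: m_def)
  have "2 * bell m \<le> bell x + lift (bell y) h"
  proof (cases "y \<le> 1/2")
    case y: True
    show ?thesis
    proof (cases "m \<le> 1/4")
      case True
      have "2 * ent m \<le> ent x + sqrt ((ent y)^2 + h^2)"
        using ent_two_point[of x y] assms y True by (simp add: m_def h_def)
      also have "\<dots> \<le> ent x + lift (ent y) h"
        by (intro add_left_mono lift_ge_norm)
      also have "\<dots> \<le> bell x + lift (bell y) h"
        using assms y h by (intro add_mono lift_mono bell_ge_ent ent_nonneg) auto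
      finally show ?thesis using True by (simp add: bell_low)
    next
      case False
      have "2 * quad (w - h) \<le> quad (w - 2 * h) + lift (quad w) h"
        using y assms h by (intro quad_two_point) (auto simp: w_def h_def)
      also have "\<dots> \<le> bell x + lift (bell y) h"
        using bell_ge_quad[of x] bell_mid[of y] assms y m False by (simp add: xw w_def)
      finally show ?thesis using bell_mid[of m] False m y by (simp add: mw)
    qed
  next
    case False
    then have w: "0 \<le> w" "w \<le> 1" and bell_y: "bell y = prof w"
      using assms by (auto simp: w_def bell_high)
    show ?thesis
    proof (cases "m \<le> 1/2")
      case True
      have "1/4 \<le> m" using False assms by (simp add: m_def)
      then have "bell m = quad (w - h)" using bell_mid[of m] True by (simp add: mw)
      moreover have x: "x \<le> 1/2" using m True by simp
      consider "x \<le> 1/16" | "h \<le> 0.47" | "1/16 \<le> x" "0.47 \<le> h" by linarith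
      then have "2 * quad (w - h) \<le> bell x + lift (prof w) h"
      proof cases
        case 1
        then show ?thesis
          using low_midpoint_small_slice[of x w h] bell_ge_ent[of x] assms w x xw by simp
      next
        case 2
        have "w \<le> h" using mw True by simp
        then show ?thesis
          using low_midpoint_norm[of w h] bell_ge_quad[of x] 2 assms w x xw by simp
      next
        case 3
        have "2 * quad (- (h - w)) \<le> ent ((1 + (- (h - w) - h)) / 2) + kap * prof (- (h - w) + h) + 1 * h"
          using mw xw True 3 assms by (intro low_midpoint_chord) auto
        moreover have "(1 + (- (h - w) - h)) / 2 = x" using xw by (simp add: field_simps)
        ultimately show ?thesis
          using lift_ge_chord[of "prof w" h] bell_ge_ent[of x] assms x by simp
      qed
      ultimately show ?thesis by (simp add: bell_y)
    next
      case m2: False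
      define c where "c = w - h"
      have c: "0 \<le> c" "c + h = w" "c - h = 2 * x - 1" "h \<le> 1 - c"
        using m2 mw xw w by (auto simp: c_def)
      have bell_m: "bell m = prof c" using bell_high[of m] m2 by (simp add: mw c_def)
      have "2 * prof c \<le> bell x + lift (prof (c + h)) h"
      proof (cases "h \<le> c")
        case hc: True
        then have "bell x = prof (c - h)" using bell_high[of x] c by simp
        moreover have "2 * prof c \<le> prof (c - h) + lift (prof (c + h)) h"
        proof (cases "h \<le> 0.35")
          case True
          show ?thesis
          proof (cases "c \<le> 1/7")
            case True
            then show ?thesis using near_upper_left[of c h] c h hc by simp
          next
            case False
            then show ?thesis using near_upper[of c h] c h \<open>h \<le> 0.35\<close> w by simp
          qed
        next
          case False
          then show ?thesis
            using far_upper_chord[of h c] c hc lift_ge_chord[of "prof (c + h)" h] by simp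
        qed
        ultimately show ?thesis by simp
      next
        case hc: False
        then have "quad (c - h) \<le> bell x" using bell_ge_quad[of x] assms c by simp
        moreover have "2 * prof c \<le> quad (c - h) + lift (prof (c + h)) h"
        proof -
          consider "h \<le> 0.35" | "0.35 \<le> h" "h \<le> 0.43" "c \<le> 0.35" | "0.43 \<le> h" "c \<le> 0.35" | "0.35 \<le> c"
            by linarith
          then show ?thesis
          proof cases
            case 1
            then show ?thesis using near_mixed[of c h] c hc by simp
          next
            case 2
            have "0.8 * prof (c + h) + 0.6 * h \<le> lift (prof (c + h)) h"
              by (rule lift_ge_line) (simp add: power2_eq_square)
            then show ?thesis using far_mixed_line[of c h] 2 c by simp
          next
            case 3
            then show ?thesis using far_mixed_chord_left[of c h] c lift_ge_chord[of "prof (c + h)" h] by simp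
          next
            case 4
            then show ?thesis using far_mixed_chord_right[of c h] c hc lift_ge_chord[of "prof (c + h)" h] by simp
          qed
        qed
        ultimately show ?thesis by simp
      qed
      then show ?thesis by (simp add: bell_y bell_m c)
    qed
  qed
  then show ?thesis by (simp add: m_def h_def)
qed

section \<open>Slices of subsets of the cube\<close>

lemma finite_cube [simp]: "finite (cube n)"
  using finite_lists_length_eq[of "UNIV :: bool set" n] by (simp add: cube_def)

lemma card_cube: "card (cube n) = 2 ^ n"
  using card_lists_length_eq[of "UNIV :: bool set" n] by (simp add: cube_def)

definition flip :: "bool list \<Rightarrow> nat \<Rightarrow> bool list" where
  "flip x i = x[i := \<not> x ! i]"

lemma differ_once_iff_flip:
  assumes "x \<in> cube n" "y \<in> cube n"
  shows "card {i. i < n \<and> x ! i \<noteq> y ! i} = 1 \<longleftrightarrow> (\<exists>i<n. y = flip x i)"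
proof
  assume "card {i. i < n \<and> x ! i \<noteq> y ! i} = 1"
  then obtain i where i: "{i. i < n \<and> x ! i \<noteq> y ! i} = {i}" by (auto simp: card_1_singleton_iff)
  then have "i < n" by blast
  moreover have "y = flip x i"
  proof (rule nth_equalityI)
    fix j assume "j < length y"
    then show "y ! j = flip x i ! j"
      using i assms by (cases "j = i") (auto simp: flip_def cube_def set_eq_iff)
  qed (use assms in \<open>auto simp: flip_def cube_def\<close>)
  ultimately show "\<exists>i<n. y = flip x i" by blast
next
  assume "\<exists>i<n. y = flip x i"
  then obtain i where "i < n" "y = flip x i" by blast
  then have "{i. i < n \<and> x ! i \<noteq> y ! i} = {i}"
    using assms by (auto simp: flip_def cube_def nth_list_update)
  then show "card {i. i < n \<and> x ! i \<noteq> y ! i} = 1" by simp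
qed

text \<open>
The boundary edges at a point correspond to the coordinates whose flip leaves the set.
\<close>

lemma boundary_degree_eq:
  assumes "A \<subseteq> cube n" "x \<in> A"
  shows "boundary_degree n A x = card {i. i < n \<and> flip x i \<notin> A}"
proof -
  have x: "x \<in> cube n" using assms by auto
  have flip_cube: "flip x i \<in> cube n" for i using x by (simp add: flip_def cube_def)
  have "{e \<in> cube_edges n. \<exists>y \<in> cube n - A. e = {x, y}} = (\<lambda>i. {x, flip x i}) ` {i. i < n \<and> flip x i \<notin> A}"
  proof (intro equalityI subsetI)
    fix e assume "e \<in> {e \<in> cube_edges n. \<exists>y \<in> cube n - A. e = {x, y}}"
    then obtain y a b where y: "y \<in> cube n" "y \<notin> A" "e = {x, y}"
      and ab: "e = {a, b}" "a \<in> cube n" "b \<in> cube n" "card {i. i < n \<and> a ! i \<noteq> b ! i} = 1"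
      by (auto simp: cube_edges_def)
    have "card {i. i < n \<and> x ! i \<noteq> y ! i} = 1"
    proof -
      have "{i. i < n \<and> a ! i \<noteq> b ! i} = {i. i < n \<and> x ! i \<noteq> y ! i}"
        using y(3) ab(1) by (auto simp: doubleton_eq_iff)
      then show ?thesis using ab(4) by simp
    qed
    then obtain i where i: "i < n" "y = flip x i"
      using differ_once_iff_flip[OF x y(1)] by blast
    then have "i \<in> {i. i < n \<and> flip x i \<notin> A}" using y(2) by simp
    then show "e \<in> (\<lambda>i. {x, flip x i}) ` {i. i < n \<and> flip x i \<notin> A}"
      unfolding y(3) i(2) by (rule imageI)
  next
    fix e assume "e \<in> (\<lambda>i. {x, flip x i}) ` {i. i < n \<and> flip x i \<notin> A}"
    then obtain i where i: "i < n" "flip x i \<notin> A" "e = {x, flip x i}" by auto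
    then have "card {j. j < n \<and> x ! j \<noteq> flip x i ! j} = 1"
      using differ_once_iff_flip[OF x flip_cube[of i]] by blast
    then show "e \<in> {e \<in> cube_edges n. \<exists>y \<in> cube n - A. e = {x, y}}"
      using i x flip_cube[of i] unfolding cube_edges_def by blast
  qed
  moreover have "inj_on (\<lambda>i. {x, flip x i}) {i. i < n \<and> flip x i \<notin> A}"
  proof (rule inj_onI)
    fix i j assume ij: "i \<in> {i. i < n \<and> flip x i \<notin> A}" "j \<in> {i. i < n \<and> flip x i \<notin> A}"
      and "{x, flip x i} = {x, flip x j}"
    then have "flip x i = flip x j" by (auto simp: doubleton_eq_iff)
    then have "flip x i ! i = flip x j ! i" by (rule arg_cong)
    moreover have "flip x i ! i \<noteq> x ! i" using ij x by (simp add: flip_def cube_def)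
    moreover have "flip x j ! i = x ! i" if "i \<noteq> j" using that by (simp add: flip_def)
    ultimately show "i = j" by metis
  qed
  ultimately show ?thesis using assms by (simp add: boundary_degree_def card_image)
qed

definition slice :: "bool \<Rightarrow> bool list set \<Rightarrow> bool list set" where
  "slice b A = {x. b # x \<in> A}"

lemma boundary_degree_Cons:
  assumes "A \<subseteq> cube (Suc n)" "b # x \<in> A"
  shows "boundary_degree (Suc n) A (b # x)
    = boundary_degree n (slice b A) x + (if x \<in> slice (\<not> b) A then 0 else 1)"
proof -
  have "slice b A \<subseteq> cube n" "x \<in> slice b A"
    using assms by (auto simp: slice_def cube_def)
  then have "boundary_degree n (slice b A) x = card {i. i < n \<and> flip x i \<notin> slice b A}"
    by (rule boundary_degree_eq)
  moreover have "{i. i < Suc n \<and> flip (b # x) i \<notin> A}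
      = Suc ` {i. i < n \<and> flip x i \<notin> slice b A} \<union> (if x \<in> slice (\<not> b) A then {} else {0})"
  proof (rule set_eqI)
    fix i show "i \<in> {i. i < Suc n \<and> flip (b # x) i \<notin> A} \<longleftrightarrow>
      i \<in> Suc ` {i. i < n \<and> flip x i \<notin> slice b A} \<union> (if x \<in> slice (\<not> b) A then {} else {0})"
      by (cases i) (auto simp: flip_def slice_def)
  qed
  moreover have "boundary_degree (Suc n) A (b # x) = card {i. i < Suc n \<and> flip (b # x) i \<notin> A}"
    by (rule boundary_degree_eq[OF assms])
  moreover have "card (Suc ` S \<union> (if P then {} else {0})) = card S + (if P then 0 else 1)"
    if "finite S" for S :: "nat set" and P
  proof -
    have "card (Suc ` S) = card S" by (rule card_image) simp
    moreover have "0 \<notin> Suc ` S" by auto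
    ultimately show ?thesis using that by auto
  qed
  ultimately show ?thesis by simp
qed

definition root_sum :: "nat \<Rightarrow> bool list set \<Rightarrow> real" where
  "root_sum n A = (\<Sum>x\<in>A. sqrt (boundary_degree n A x))"

lemma sum_over_slices:
  assumes "A \<subseteq> cube (Suc n)"
  shows "(\<Sum>x\<in>A. f x) = (\<Sum>x\<in>slice b A. f (b # x)) + (\<Sum>x\<in>slice (\<not> b) A. f ((\<not> b) # x))"
proof -
  have "finite (slice c A)" for c
    by (rule finite_subset[OF _ finite_cube[of n]]) (use assms in \<open>auto simp: slice_def cube_def\<close>)
  moreover have "A = (Cons b) ` slice b A \<union> (Cons (\<not> b)) ` slice (\<not> b) A"
  proof (rule set_eqI)
    fix x
    show "x \<in> A \<longleftrightarrow> x \<in> (Cons b) ` slice b A \<union> (Cons (\<not> b)) ` slice (\<not> b) A"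
    proof (cases x)
      case Nil
      then show ?thesis using assms by (auto simp: cube_def)
    next
      case (Cons a l)
      then show ?thesis by (cases "a = b") (auto simp: slice_def image_iff)
    qed
  qed
  moreover have "(Cons b) ` slice b A \<inter> (Cons (\<not> b)) ` slice (\<not> b) A = {}" by auto
  ultimately have "(\<Sum>x\<in>A. f x) = (\<Sum>x\<in>(Cons b) ` slice b A. f x) + (\<Sum>x\<in>(Cons (\<not> b)) ` slice (\<not> b) A. f x)"
    by (metis (no_types, lifting) finite_imageI sum.union_disjoint)
  then show ?thesis by (simp add: sum.reindex inj_on_def)
qed

text \<open>
As a function of s = sqrt k the right side sqrt (1 + s^2) is convex; the left side is its chord
between s = 0 and s = 1, and no value of s strictly between them occurs.
\<close>

lemma sqrt_Suc_ge_chord: "1 + kap * sqrt (real k) \<le> sqrt (real (Suc k))"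
proof (cases "k = 0")
  case False
  then have "1 \<le> real k" by simp
  then have s: "1 \<le> sqrt (real k)" by simp
  have "2 * kap * 1 \<le> 2 * kap * sqrt (real k)"
    using s kap_bounds by (intro mult_left_mono) auto
  moreover have "2 * kap * (sqrt (real k) * 1) \<le> 2 * kap * (sqrt (real k) * sqrt (real k))"
    using s kap_bounds by (intro mult_left_mono) auto
  moreover have "(1 + kap * sqrt (real k))^2 = 1 + 2 * kap * sqrt (real k) + kap^2 * (sqrt (real k))^2"
    by (simp add: power2_eq_square algebra_simps)
  moreover have "\<dots> = 1 + 2 * kap * sqrt (real k) + (1 - 2 * kap) * (sqrt (real k))^2"
    by (simp add: kap_sq)
  ultimately have "(1 + kap * sqrt (real k))^2 \<le> 1 + (sqrt (real k))^2"
    by (simp add: power2_eq_square algebra_simps)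
  then show ?thesis by (intro real_le_rsqrt) simp
qed simp

text \<open>
The triangle inequality is applied to complex numbers, with the square roots as real parts and
the indicator function of T as imaginary part.
\<close>

lemma lift_le_sum_sqrt:
  fixes d :: "'a \<Rightarrow> nat"
  assumes "finite S" "T \<subseteq> S"
  shows "lift (\<Sum>x\<in>S. sqrt (d x)) (card T) \<le> (\<Sum>x\<in>S. sqrt (d x + (if x \<in> T then 1 else 0)))"
proof -
  have card: "real (card T) = (\<Sum>x\<in>S. if x \<in> T then 1 else 0)"
    using assms by (simp add: sum.If_cases Int_absorb1)
  let ?z = "\<lambda>x. Complex (sqrt (d x)) (if x \<in> T then 1 else 0)"
  have "sqrt ((\<Sum>x\<in>S. sqrt (d x))^2 + (real (card T))^2) = norm (\<Sum>x\<in>S. ?z x)"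
    unfolding card by (simp add: cmod_def)
  also have "\<dots> \<le> (\<Sum>x\<in>S. norm (?z x))" by (rule norm_sum)
  also have "\<dots> = (\<Sum>x\<in>S. sqrt (d x + (if x \<in> T then 1 else 0)))"
    by (intro sum.cong) (auto simp: cmod_def)
  finally have norm: "sqrt ((\<Sum>x\<in>S. sqrt (d x))^2 + (real (card T))^2) \<le> \<dots>" .
  have "kap * (\<Sum>x\<in>S. sqrt (d x)) + card T = (\<Sum>x\<in>S. kap * sqrt (d x) + (if x \<in> T then 1 else 0))"
    unfolding card by (simp add: sum.distrib sum_distrib_left)
  also have "\<dots> \<le> (\<Sum>x\<in>S. sqrt (d x + (if x \<in> T then 1 else 0)))"
  proof (rule sum_mono)
    fix x
    have "kap * sqrt (d x) \<le> 1 * sqrt (d x)" using kap_bounds by (intro mult_right_mono) auto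
    then show "kap * sqrt (d x) + (if x \<in> T then 1 else 0) \<le> sqrt (d x + (if x \<in> T then 1 else 0))"
      using sqrt_Suc_ge_chord[of "d x"] by (auto simp: add.commute)
  qed
  finally show ?thesis using norm by (simp add: lift_def)
qed

lemma root_sum_Suc:
  assumes A: "A \<subseteq> cube (Suc n)" and le: "card (slice (\<not> b) A) \<le> card (slice b A)"
  shows "root_sum n (slice (\<not> b) A) + lift (root_sum n (slice b A)) (card (slice b A) - card (slice (\<not> b) A))
    \<le> root_sum (Suc n) A"
proof -
  let ?X = "slice (\<not> b) A" and ?Y = "slice b A"
  have fin: "finite (slice c A)" for c
    by (rule finite_subset[OF _ finite_cube[of n]]) (use A in \<open>auto simp: slice_def cube_def\<close>)
  have "real (card ?Y) - real (card ?X) \<le> card (?Y - ?X)"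
    using card_Diff_subset_Int[of ?Y ?X] card_mono[of ?X "?Y \<inter> ?X"] fin by simp
  then have "lift (root_sum n ?Y) (card ?Y - card ?X) \<le> lift (root_sum n ?Y) (card (?Y - ?X))"
    using le by (intro lift_mono) (auto simp: root_sum_def sum_nonneg)
  also have "\<dots> \<le> (\<Sum>x\<in>?Y. sqrt (boundary_degree n ?Y x + (if x \<in> ?Y - ?X then 1 else 0)))"
    unfolding root_sum_def using fin by (intro lift_le_sum_sqrt) auto
  also have "\<dots> = (\<Sum>x\<in>?Y. sqrt (boundary_degree (Suc n) A (b # x)))"
    using A by (intro sum.cong) (auto simp: boundary_degree_Cons slice_def)
  finally have Y: "lift (root_sum n ?Y) (card ?Y - card ?X) \<le> \<dots>" .
  have "root_sum n ?X \<le> (\<Sum>x\<in>?X. sqrt (boundary_degree (Suc n) A ((\<not> b) # x)))"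
    unfolding root_sum_def using A by (intro sum_mono) (auto simp: boundary_degree_Cons slice_def)
  with Y show ?thesis
    unfolding root_sum_def[of "Suc n" A] sum_over_slices[OF A, of _ b] by simp
qed

section \<open>The isoperimetric inequality\<close>

lemma root_sum_ge_bell:
  "A \<subseteq> cube n \<Longrightarrow> 2 ^ n * bell (card A / 2 ^ n) \<le> root_sum n A"
proof (induction n arbitrary: A)
  case 0
  then have "card A \<in> {0, 1}"
    using card_mono[OF finite_cube[of 0] 0] by (auto simp: card_cube)
  then have "bell (card A) = 0" by auto
  then show ?case by (simp add: root_sum_def sum_nonneg)
next
  case (Suc n)
  define b where "b \<longleftrightarrow> card (slice False A) \<le> card (slice True A)"
  have le: "card (slice (\<not> b) A) \<le> card (slice b A)"
    by (cases "card (slice False A) \<le> card (slice True A)") (auto simp: b_def)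
  have sub: "slice c A \<subseteq> cube n" for c using Suc.prems by (auto simp: slice_def cube_def)
  define x where "x = card (slice (\<not> b) A) / 2 ^ n"
  define y where "y = card (slice b A) / 2 ^ n"
  have "card (slice b A) \<le> 2 ^ n"
    using card_mono[OF finite_cube sub] by (simp add: card_cube)
  then have xy: "0 \<le> x" "x \<le> y" "y \<le> 1" using le
    by (auto simp: x_def y_def divide_simps)
  have "card A = card (slice b A) + card (slice (\<not> b) A)"
    using sum_over_slices[OF Suc.prems, of "\<lambda>_. 1 :: nat" b] by simp
  then have mean: "card A / 2 ^ Suc n = (x + y) / 2"
    by (simp add: x_def y_def field_simps)
  have "2 ^ Suc n * bell (card A / 2 ^ Suc n) = 2 ^ n * (2 * bell ((x + y) / 2))"
    unfolding mean by simp
  also have "\<dots> \<le> 2 ^ n * (bell x + lift (bell y) (y - x))"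
    by (intro mult_left_mono bell_two_point xy) simp
  also have "\<dots> = 2 ^ n * bell x + lift (2 ^ n * bell y) (2 ^ n * (y - x))"
    by (simp add: lift_scale distrib_left)
  also have "\<dots> \<le> root_sum n (slice (\<not> b) A) + lift (root_sum n (slice b A)) (card (slice b A) - card (slice (\<not> b) A))"
  proof (intro add_mono lift_mono)
    show "2 ^ n * bell x \<le> root_sum n (slice (\<not> b) A)" "2 ^ n * bell y \<le> root_sum n (slice b A)"
      unfolding x_def y_def by (intro Suc.IH sub)+
    show "2 ^ n * (y - x) \<le> real (card (slice b A) - card (slice (\<not> b) A))"
      using le by (simp add: x_def y_def of_nat_diff field_simps)
  qed (use xy bell_nonneg[of y] in auto)
  also have "\<dots> \<le> root_sum (Suc n) A"
    using root_sum_Suc[OF Suc.prems le] le by (simp add: of_nat_diff)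
  finally show ?case .
qed

lemma cube_measure_eq:
  assumes "A \<subseteq> cube n"
  shows "cube_measure n A = card A / 2 ^ n"
proof -
  have "(\<Sum>x\<in>cube n. indicator A x) = real (card A)"
    using assms by (simp add: indicator_def sum.If_cases Int_absorb1)
  then show ?thesis by (simp add: cube_measure_def cube_mean_def)
qed

lemma cube_mean_boundary_degree:
  assumes "A \<subseteq> cube n"
  shows "cube_mean n (\<lambda>x. real (boundary_degree n A x) powr \<beta>)
    = (\<Sum>x\<in>A. real (boundary_degree n A x) powr \<beta>) / 2 ^ n"
  unfolding cube_mean_def
  by (rule arg_cong[where f = "\<lambda>s. s / 2 ^ n"], rule sum.mono_neutral_right)
     (use assms in \<open>auto simp: boundary_degree_def\<close>)

lemma ent_mean_bound:
  assumes "A \<subseteq> cube n" "card A / 2 ^ n \<le> 1/2"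
  shows "card A * sqrt (log 2 (1 / (card A / 2 ^ n))) \<le> root_sum n A"
proof -
  have "2 ^ n * ent (card A / 2 ^ n) \<le> 2 ^ n * bell (card A / 2 ^ n)"
    using assms by (intro mult_left_mono bell_ge_ent) auto
  also have "\<dots> \<le> root_sum n A" by (rule root_sum_ge_bell[OF assms(1)])
  finally show ?thesis by (simp add: ent_def)
qed

text \<open>
The tangent of t powr p at c is below its graph, and the first-order terms sum to something
nonnegative.
\<close>

lemma power_mean:
  fixes s :: "'a \<Rightarrow> real" and c p :: real
  assumes "finite S" "1 \<le> p" "\<And>x. x \<in> S \<Longrightarrow> 0 \<le> s x" "0 \<le> c" "card S * c \<le> (\<Sum>x\<in>S. s x)"
  shows "card S * c powr p \<le> (\<Sum>x\<in>S. s x powr p)"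
proof (cases "c = 0")
  case True
  then show ?thesis using assms by (simp add: sum_nonneg)
next
  case False
  then have c: "0 < c" using assms by simp
  have tangent: "c powr p + p * c powr (p - 1) * (t - c) \<le> t powr p" if "0 \<le> t" for t
  proof (cases "t = 0")
    case True
    have "c powr p = c powr (p - 1) * c" using c by (simp add: powr_diff)
    then show ?thesis using True assms c by (simp add: algebra_simps mult_right_mono)
  next
    case False
    then have t: "0 < t" using that by simp
    have "p * c powr (p - 1) * (t - c) \<le> t powr p - c powr p"
    proof (rule convex_on_imp_above_tangent[OF powr_convex[OF assms(2)]])
      show "((\<lambda>x. x powr p) has_real_derivative p * c powr (p - 1)) (at c within {0<..})"
        using c by (auto intro!: derivative_eq_intros)
    qed (use c t in \<open>auto simp: interior_open\<close>)
    then show ?thesis by simp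
  qed
  have "card S * c powr p \<le> card S * c powr p + p * c powr (p - 1) * ((\<Sum>x\<in>S. s x) - card S * c)"
    using assms by simp
  also have "\<dots> = (\<Sum>x\<in>S. c powr p + p * c powr (p - 1) * (s x - c))"
    by (simp add: sum.distrib sum_distrib_left[symmetric] sum_subtractf)
  also have "\<dots> \<le> (\<Sum>x\<in>S. s x powr p)"
    using assms tangent by (intro sum_mono) auto
  finally show ?thesis .
qed

lemma isoperimetric_inequality:
  assumes "1/2 \<le> \<beta>" "A \<subseteq> cube n" "card A / 2 ^ n \<le> 1/2"
  shows "card A * log 2 (1 / (card A / 2 ^ n)) powr \<beta> \<le> (\<Sum>x\<in>A. real (boundary_degree n A x) powr \<beta>)"
proof (cases "A = {}")
  case False
  have fin: "finite A" using assms finite_subset finite_cube by blast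
  let ?l = "log 2 (1 / (card A / 2 ^ n))"
  have "0 < card A / 2 ^ n" using False fin by (simp add: card_gt_0_iff)
  moreover have "card A / 2 ^ n \<le> 1" using assms(3) by linarith
  ultimately have "1 \<le> 1 / (card A / 2 ^ n)" by (subst le_divide_eq_1_pos)
  then have l: "0 \<le> ?l" by (subst zero_le_log_cancel_iff) auto
  have powr_sqrt: "sqrt t powr (2 * \<beta>) = t powr \<beta>" if "0 \<le> t" for t :: real
    using that by (simp add: powr_half_sqrt[symmetric] powr_powr)
  have "card A * sqrt ?l powr (2 * \<beta>) \<le> (\<Sum>x\<in>A. sqrt (boundary_degree n A x) powr (2 * \<beta>))"
    using assms l fin ent_mean_bound[OF assms(2,3)] by (intro power_mean) (auto simp: root_sum_def)
  then show ?thesis using l by (simp add: powr_sqrt)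
qed simp

lemma subcube_boundary_degree:
  assumes "I \<subseteq> {..<n}" "x \<in> cube n" "\<forall>i\<in>I. x ! i = c i"
  shows "boundary_degree n {x \<in> cube n. \<forall>i\<in>I. x ! i = c i} x = card I"
proof -
  have "{i. i < n \<and> flip x i \<notin> {x \<in> cube n. \<forall>i\<in>I. x ! i = c i}} = I"
    using assms by (auto simp: flip_def cube_def nth_list_update subset_iff split: if_splits)
  then show ?thesis using assms by (subst boundary_degree_eq) auto
qed

lemma subcube_measure:
  assumes "I \<subseteq> {..<n}"
  shows "card {x \<in> cube n. \<forall>i\<in>I. x ! i = c i} / 2 ^ n = 1 / 2 ^ card I"
proof -
  let ?f = "\<lambda>x. {i \<in> {..<n} - I. x ! i}"
  have "bij_betw ?f {x \<in> cube n. \<forall>i\<in>I. x ! i = c i} (Pow ({..<n} - I))"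
  proof (rule bij_betw_imageI)
    show "inj_on ?f {x \<in> cube n. \<forall>i\<in>I. x ! i = c i}"
    proof (rule inj_onI)
      fix x y assume x: "x \<in> {x \<in> cube n. \<forall>i\<in>I. x ! i = c i}"
        and y: "y \<in> {x \<in> cube n. \<forall>i\<in>I. x ! i = c i}" and eq: "?f x = ?f y"
      show "x = y"
      proof (rule nth_equalityI)
        fix i assume "i < length x"
        then have i: "i < n" using x by (simp add: cube_def)
        show "x ! i = y ! i"
        proof (cases "i \<in> I")
          case True
          then show ?thesis using x y by simp
        next
          case False
          then have "i \<in> ?f x \<longleftrightarrow> x ! i" "i \<in> ?f y \<longleftrightarrow> y ! i" using i by simp_all
          moreover have "i \<in> ?f x \<longleftrightarrow> i \<in> ?f y" unfolding eq ..
          ultimately show ?thesis by blast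
        qed
      qed (use x y in \<open>simp add: cube_def\<close>)
    qed
    show "?f ` {x \<in> cube n. \<forall>i\<in>I. x ! i = c i} = Pow ({..<n} - I)"
    proof (intro equalityI subsetI)
      fix S assume S: "S \<in> Pow ({..<n} - I)"
      define x where "x = map (\<lambda>i. if i \<in> I then c i else i \<in> S) [0..<n]"
      have nth: "x ! i = (if i \<in> I then c i else i \<in> S)" if "i < n" for i
        using that by (simp add: x_def)
      have "x \<in> {x \<in> cube n. \<forall>i\<in>I. x ! i = c i}"
        using assms nth by (auto simp: cube_def x_def)
      moreover have "?f x = S" using S nth by auto
      ultimately show "S \<in> ?f ` {x \<in> cube n. \<forall>i\<in>I. x ! i = c i}" by blast
    qed blast
  qed
  then have "card {x \<in> cube n. \<forall>i\<in>I. x ! i = c i} = card (Pow ({..<n} - I))"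
    by (rule bij_betw_same_card)
  also have "\<dots> = 2 ^ (n - card I)"
    using assms by (simp add: card_Pow card_Diff_subset finite_subset)
  finally have "real (card {x \<in> cube n. \<forall>i\<in>I. x ! i = c i}) = 2 ^ (n - card I)" by simp
  moreover have "(2::real) ^ n = 2 ^ (n - card I) * 2 ^ card I"
    using card_mono[OF finite_lessThan assms] by (simp flip: power_add)
  ultimately show ?thesis by simp
qed

theorem theorem1p1:
  fixes \<beta> :: real and n :: nat and A :: "bool list set"
  assumes "\<beta> \<ge> beta0"
    and "n \<ge> 1"
    and "A \<subseteq> cube n"
    and "cube_measure n A \<le> 1 / 2"
  shows "cube_mean n (\<lambda>x. real (boundary_degree n A x) powr \<beta>)
           \<ge> cube_measure n A * (log 2 (1 / cube_measure n A)) powr \<beta>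
       \<and> (is_subcube n A \<longrightarrow>
           cube_mean n (\<lambda>x. real (boundary_degree n A x) powr \<beta>)
             = cube_measure n A * (log 2 (1 / cube_measure n A)) powr \<beta>)"
proof
  have beta: "1/2 \<le> \<beta>" using assms(1) by (simp add: beta0_def)
  show "cube_measure n A * (log 2 (1 / cube_measure n A)) powr \<beta>
      \<le> cube_mean n (\<lambda>x. real (boundary_degree n A x) powr \<beta>)"
    using isoperimetric_inequality[OF beta assms(3)] assms(4)
    unfolding cube_mean_boundary_degree[OF assms(3)] cube_measure_eq[OF assms(3)]
    by (simp add: divide_right_mono)
  show "is_subcube n A \<longrightarrow> cube_mean n (\<lambda>x. real (boundary_degree n A x) powr \<beta>)
      = cube_measure n A * (log 2 (1 / cube_measure n A)) powr \<beta>"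
  proof
    assume "is_subcube n A"
    then obtain I c where I: "I \<subseteq> {..<n}" and A: "A = {x \<in> cube n. \<forall>i\<in>I. x ! i = c i}"
      by (auto simp: is_subcube_def)
    have measure: "cube_measure n A = 1 / 2 ^ card I"
      unfolding cube_measure_eq[OF assms(3)] unfolding A by (rule subcube_measure[OF I])
    have "(\<Sum>x\<in>A. real (boundary_degree n A x) powr \<beta>) = (\<Sum>x\<in>A. real (card I) powr \<beta>)"
      by (rule sum.cong) (use subcube_boundary_degree[OF I] A in auto)
    then have "cube_mean n (\<lambda>x. real (boundary_degree n A x) powr \<beta>) = cube_measure n A * real (card I) powr \<beta>"
      unfolding cube_mean_boundary_degree[OF assms(3)] cube_measure_eq[OF assms(3)] by simp
    moreover have "log 2 (1 / cube_measure n A) = card I"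
      by (simp add: measure log_nat_power)
    ultimately show "cube_mean n (\<lambda>x. real (boundary_degree n A x) powr \<beta>)
      = cube_measure n A * (log 2 (1 / cube_measure n A)) powr \<beta>" by simp
  qed
qed

end
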